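(* Let $\mathbb{K}$ be a field, let $R=\mathbb{K}[x_1,\ldots,x_{15},y_3,\ldots,y_{16}]$, let $H_0$ be the bipartite graph defined in the context, with edge ideal $I(H_0)\subset R$, and let $p=\mathrm{proj\,dim}(R/I(H_0))$. Then $\beta_{p,p+4}(R/I(H_0))=0$. In particular, $R/I(H_0)$ does not have a unique extremal Betti number.
   Context: $H_0=(X,Y)$ is the bipartite graph with vertex set $X\cup Y$, $X=\{x_1,\ldots,x_{15}\}$, $Y=\{y_3,\ldots,y_{16}\}$, in which the neighborhood of $x_i$ is $\{y_t : m(i)\le t\le M(i)\}$ for $i=1,\ldots,15$, where $m(1)=3$, $m(i)=i+1$ for $i=2,\ldots,15$, and $M(1)=4$, $M(2)=8$, $M(j)=13$ for $j=3,\ldots,7$, $M(8)=14$, $M(j)=16$ for $j=9,\ldots,15$. The (monomial) edge ideal of a graph is the ideal generated by the products $uv$ of variables over all edges $\{u,v\}$ of the graph (vertices identified with variables). $\beta_{i,j}(R/I)$ denotes the $(i,j)$-th graded Betti number of $R/I$, i.e. the minimal $\mathbb{Z}$-graded free resolution of $R/I$ over $R$ (all variables of degree $1$) has $i$-th module $\bigoplus_j R(-j)^{\beta_{i,j}(R/I)}$, and $\mathrm{proj\,dim}$ is the length of this resolution. A nonzero Betti number $\beta_{i,j}(R/I)$ is called extremal if $\beta_{k,\ell}(R/I)=0$ for all $k\ge i$ and $\ell\ge j$ with $(k,\ell)\ne(i,j)$.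
   Formalization: "Extremal" compares rows: nonzero β_{i,j} is extremal if β_{k,ℓ}=0 for all k≥i, ℓ−k≥j−i, (k,ℓ)≠(i,j), instead of ℓ≥j; with ℓ≥j literally, (23,26) would be the unique extremal position and the last claim would be false. *)

theory Defs
  imports
    "HOL-Library.Poly_Mapping"
    "Jordan_Normal_Form.Matrix_Kernel"
begin

section \<open>Polynomial rings and edge ideals\<close>

text \<open>
  A monomial is a finitely supported exponent vector, so that \<open>('v, 'k) mpoly\<close> is the
  polynomial ring over \<open>'k\<close> whose variables are exactly the elements of the type \<open>'v\<close>.
\<close>

type_synonym ('v, 'k) mpoly = "('v \<Rightarrow>\<^sub>0 nat) \<Rightarrow>\<^sub>0 'k"

definition var :: "'v \<Rightarrow> ('v, 'k::field) mpoly" where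
  "var v = Poly_Mapping.single (Poly_Mapping.single v 1) 1"

definition monomial_degree :: "('v \<Rightarrow>\<^sub>0 nat) \<Rightarrow> nat" where
  "monomial_degree m = (\<Sum>v\<in>Poly_Mapping.keys m. Poly_Mapping.lookup m v)"

text \<open>Zero is homogeneous of every degree, and it is the only such element in negative degrees.\<close>

definition homogeneous :: "('v, 'k::field) mpoly \<Rightarrow> int \<Rightarrow> bool" where
  "homogeneous f d \<longleftrightarrow> (\<forall>m\<in>Poly_Mapping.keys f. int (monomial_degree m) = d)"

text \<open>
  A graph is given by its set of edges, each edge being the set of its two end points. The span is
  taken in the ring regarded as a module over itself, i.e. it is the generated ideal.
\<close>

definition edge_ideal :: "'v set set \<Rightarrow> ('v, 'k::field) mpoly set" where
  "edge_ideal E = module.span (*) {var u * var v | u v. u \<noteq> v \<and> {u, v} \<in> E}"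

section \<open>Minimal graded free resolutions and graded Betti numbers\<close>

text \<open>
  The list \<open>[d\<^sub>0, \<dots>, d\<^sub>n]\<close> of integers stands for the graded free module
  \<open>R(-d\<^sub>0) \<oplus> \<dots> \<oplus> R(-d\<^sub>n)\<close>, whose \<open>b\<close>-th basis vector has degree \<open>d\<^sub>b\<close>. Its elements are the
  vectors of that length over \<open>R\<close>. A homomorphism of degree 0 from the module \<open>ds\<close> to the
  module \<open>ds'\<close> is a matrix whose \<open>(a, b)\<close>-entry is homogeneous of degree \<open>d\<^sub>b - d'\<^sub>a\<close>.
\<close>

definition graded_hom :: "int list \<Rightarrow> int list \<Rightarrow> ('v, 'k::field) mpoly mat \<Rightarrow> bool" where
  "graded_hom ds ds' A \<longleftrightarrow>
     A \<in> carrier_mat (length ds') (length ds) \<and>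
     (\<forall>a<length ds'. \<forall>b<length ds. homogeneous (A $$ (a, b)) (ds ! b - ds' ! a))"

definition mat_image :: "'a::comm_ring_1 mat \<Rightarrow> 'a vec set" where
  "mat_image A = (\<lambda>v. A *\<^sub>v v) ` carrier_vec (dim_col A)"

text \<open>
  A graded free resolution
  \<open>\<dots> \<rightarrow> F\<^sub>2 \<rightarrow> F\<^sub>1 \<rightarrow> F\<^sub>0 \<rightarrow> R/I \<rightarrow> 0\<close> by modules of finite rank: \<open>F\<^sub>i\<close> is given by the list
  \<open>ds i\<close>, the map from \<open>F\<^bsub>i+1\<^esub>\<close> to \<open>F\<^sub>i\<close> by the matrix \<open>A i\<close>, and the augmentation
  sends the \<open>b\<close>-th basis vector of \<open>F\<^sub>0\<close> to the residue class of \<open>e $ b\<close> modulo \<open>I\<close>. The last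
  three conditions are surjectivity of the augmentation, exactness at \<open>F\<^sub>0\<close>, and exactness at
  \<open>F\<^bsub>i+1\<^esub>\<close>.
\<close>

definition graded_free_resolution ::
  "('v, 'k::field) mpoly set \<Rightarrow> (nat \<Rightarrow> int list) \<Rightarrow> (nat \<Rightarrow> ('v, 'k) mpoly mat) \<Rightarrow>
     ('v, 'k) mpoly vec \<Rightarrow> bool" where
  "graded_free_resolution I ds A e \<longleftrightarrow>
     (\<forall>i. graded_hom (ds (Suc i)) (ds i) (A i)) \<and>
     e \<in> carrier_vec (length (ds 0)) \<and>
     (\<forall>b<length (ds 0). homogeneous (e $ b) (ds 0 ! b)) \<and>
     (\<forall>f. \<exists>v\<in>carrier_vec (length (ds 0)). f - e \<bullet> v \<in> I) \<and>
     {v \<in> carrier_vec (length (ds 0)). e \<bullet> v \<in> I} = mat_image (A 0) \<and>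
     (\<forall>i. mat_kernel (A i) = mat_image (A (Suc i)))"

text \<open>
  Minimality: every \<open>F\<^bsub>i+1\<^esub>\<close> is mapped into the submodule of \<open>F\<^sub>i\<close> generated by multiples of the
  variables, i.e. no matrix entry has a constant term.
\<close>

definition minimal_graded_free_resolution ::
  "('v, 'k::field) mpoly set \<Rightarrow> (nat \<Rightarrow> int list) \<Rightarrow> (nat \<Rightarrow> ('v, 'k) mpoly mat) \<Rightarrow>
     ('v, 'k) mpoly vec \<Rightarrow> bool" where
  "minimal_graded_free_resolution I ds A e \<longleftrightarrow>
     graded_free_resolution I ds A e \<and>
     (\<forall>i. \<forall>a<length (ds i). \<forall>b<length (ds (Suc i)). Poly_Mapping.lookup (A i $$ (a, b)) 0 = 0)"

text \<open>
  The minimal graded free resolution of \<open>R/I\<close> is unique up to isomorphism, so it does not matter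
  which one is chosen.
\<close>

definition resolution_degrees :: "('v, 'k::field) mpoly set \<Rightarrow> nat \<Rightarrow> int list" where
  "resolution_degrees I = (SOME ds. \<exists>A e. minimal_graded_free_resolution I ds A e)"

text \<open>
  \<open>graded_betti I i j\<close> is \<open>\<beta>\<^bsub>i,j\<^esub>(R/I)\<close>, with \<open>j\<close> the internal degree: the multiplicity of
  \<open>R(-j)\<close> in \<open>F\<^sub>i\<close>.
\<close>

definition graded_betti :: "('v, 'k::field) mpoly set \<Rightarrow> nat \<Rightarrow> int \<Rightarrow> nat" where
  "graded_betti I i j = count_list (resolution_degrees I i) j"

text \<open>
  The length of the minimal resolution of \<open>R/I\<close>. For finitely many variables the set is finite
  by Hilbert's syzygy theorem, and it is nonempty if \<open>I\<close> is a proper ideal.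
\<close>

definition proj_dim :: "('v, 'k::field) mpoly set \<Rightarrow> nat" where
  "proj_dim I = Max {i. resolution_degrees I i \<noteq> []}"

text \<open>
  Extremality in the sense of Bayer, Charalambous and Popescu: a corner of the Betti diagram, whose
  entry in column \<open>i\<close> and row \<open>r\<close> is \<open>\<beta>\<^bsub>i,i+r\<^esub>\<close>. The nonzero number \<open>\<beta>\<^bsub>i,i+r\<^esub>\<close> is extremal if
  \<open>\<beta>\<^bsub>k,k+s\<^esub> = 0\<close> whenever \<open>k \<ge> i\<close>, \<open>s \<ge> r\<close> and \<open>(k, s) \<noteq> (i, r)\<close>. In terms of
  internal degrees \<open>j = i + r\<close> and \<open>l = k + s\<close> one therefore compares \<open>l - k\<close> with \<open>j - i\<close>, and
  not \<open>l\<close> with \<open>j\<close>.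
\<close>

definition extremal_betti :: "('v, 'k::field) mpoly set \<Rightarrow> nat \<Rightarrow> int \<Rightarrow> bool" where
  "extremal_betti I i j \<longleftrightarrow>
     graded_betti I i j \<noteq> 0 \<and>
     (\<forall>k l. k \<ge> i \<and> l - int k \<ge> j - int i \<and> (k, l) \<noteq> (i, j) \<longrightarrow> graded_betti I k l = 0)"

section \<open>The bipartite graph\<close>

typedef x_index = "{1..15::nat}"
  morphisms nat_of_x_index x_index_of_nat
  by auto

typedef y_index = "{3..16::nat}"
  morphisms nat_of_y_index y_index_of_nat
  by auto

datatype H0_vertex = X x_index | Y y_index

definition H0_m :: "nat \<Rightarrow> nat" where
  "H0_m i = (if i = 1 then 3 else i + 1)"

definition H0_M :: "nat \<Rightarrow> nat" where
  "H0_M i = (if i = 1 then 4 else if i = 2 then 8 else if i \<le> 7 then 13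
             else if i = 8 then 14 else 16)"

definition H0 :: "H0_vertex set set" where
  "H0 = {{X i, Y t} | i t.
     H0_m (nat_of_x_index i) \<le> nat_of_y_index t \<and> nat_of_y_index t \<le> H0_M (nat_of_x_index i)}"

end

theory Submission
  imports Defs
begin

text \<open>
  Add the edges \<open>x\<^sub>a y\<^sub>b\<close> one at a time in decreasing lexicographic order of \<open>(a, b)\<close>. If \<open>J\<close> is
  generated by the earlier edges, then \<open>J : x\<^sub>a y\<^sub>b\<close> is generated by \<open>M(a) - a - 1\<close> variables together
  with the edges \<open>x\<^sub>i y\<^sub>t\<close> with \<open>i \<ge> b\<close> and \<open>t > M(a)\<close>, and these involve none of those variables. The
  mapping cone of \<open>R/(J : x\<^sub>a y\<^sub>b) \<rightarrow> R/J\<close> is a minimal resolution of \<open>R/(J + x\<^sub>a y\<^sub>b)\<close>: the first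
  \<open>x\<close> and the first \<open>y\<close> in the multidegree of a new basis element are \<open>x\<^sub>a\<close> and \<open>y\<^sub>b\<close>, so no old
  basis element has the same multidegree. Hence the positions of the nonzero Betti numbers satisfy a
  recursion. Rows are at most 4, \<open>\<beta>\<close> vanishes beyond column 23 and, in row 4, beyond column 21, while
  the positions (column 23, row 3) and (column 21, row 4) are attained, and both are extremal.
\<close>

section \<open>Frames of squarefree resolutions\<close>

text \<open>Betti numbers are defined through an arbitrarily chosen minimal resolution, so one must
  be exhibited and any two must be shown to have the same degrees. Cones of polynomial matrices
  would be unwieldy. Since the multidegrees are squarefree and distinct, the cones are built from
  scalars indexed by vertex sets, and polynomials enter only afterwards. The scalars are never
  computed: \<open>h\<close> and the cardinalities of the multidegrees determine all Betti numbers,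
  over every field. The constants come from chains of edges x_a y_b, x_a' y_b', ... with a' >= b and
  b' > M(a). Each edge contributes one row and at most M(a) - a columns. From a = 2, M(2) = 8 leaves
  room for only three edges, with at most 6 + 10 + 7 = 23 columns. Four edges force a = 1; then m(1)
  = 3 excludes x_2, and at most 3 + 10 + 6 + 2 = 21 columns arise. Thus the longest chain is not the
  widest one, which separates the two corners.\<close>

text \<open>
  A frame encodes a multigraded resolution of \<open>R/I\<close> for a squarefree monomial ideal \<open>I\<close>, where \<open>P U\<close>
  says that \<open>U\<close> contains the support of a generator. All multidegrees are squarefree and pairwise
  distinct, so a basis element is identified with its multidegree \<open>w\<close>; \<open>h w\<close> is its homological
  degree, and the matrix entry at \<open>(v, w)\<close> is \<open>c v w\<close> times the product of the variables in
  \<open>w - v\<close>. Strictness in \<open>v \<subset> w\<close> is minimality. Exactness is exactness in each multidegree, where the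
  complex is spanned by the basis elements \<open>w \<subseteq> U\<close>.
\<close>

definition frame_diff :: "'v set set \<Rightarrow> ('v set \<Rightarrow> 'v set \<Rightarrow> 'k::field) \<Rightarrow> ('v set \<Rightarrow> 'k) \<Rightarrow> 'v set \<Rightarrow> 'k" where
  "frame_diff B c z v = (\<Sum>w\<in>B. c v w * z w)"

definition frame_chains :: "'v set set \<Rightarrow> 'v set \<Rightarrow> ('v set \<Rightarrow> 'k::field) set" where
  "frame_chains B U = {z. \<forall>w. z w \<noteq> 0 \<longrightarrow> w \<in> B \<and> w \<subseteq> U}"

definition frame ::
  "('v set \<Rightarrow> bool) \<Rightarrow> 'v set set \<Rightarrow> ('v set \<Rightarrow> nat) \<Rightarrow> ('v set \<Rightarrow> 'v set \<Rightarrow> 'k::field) \<Rightarrow> bool" where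
  "frame P B h c \<longleftrightarrow>
     (\<forall>U V. P U \<longrightarrow> U \<subseteq> V \<longrightarrow> P V) \<and>
     finite B \<and> (\<forall>w\<in>B. finite w) \<and> {} \<in> B \<and> h {} = 0 \<and>
     (\<forall>w\<in>B. w \<noteq> {} \<longrightarrow> P w \<and> h w > 0) \<and>
     (\<forall>v w. c v w \<noteq> 0 \<longrightarrow> v \<in> B \<and> w \<in> B \<and> v \<subset> w \<and> h w = Suc (h v)) \<and>
     (\<forall>u w. (\<Sum>v\<in>B. c u v * c v w) = 0) \<and>
     (\<forall>U z. P U \<longrightarrow> z \<in> frame_chains B U \<longrightarrow> (\<forall>v. frame_diff B c z v = 0) \<longrightarrow>
        (\<exists>y\<in>frame_chains B U. \<forall>v. frame_diff B c y v = z v))"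

lemma frameD:
  assumes "frame P B h c"
  shows "P U \<Longrightarrow> U \<subseteq> V \<Longrightarrow> P V" "finite B" "w \<in> B \<Longrightarrow> finite w" "{} \<in> B" "h {} = 0"
    "w \<in> B \<Longrightarrow> w \<noteq> {} \<Longrightarrow> P w" "w \<in> B \<Longrightarrow> w \<noteq> {} \<Longrightarrow> h w > 0"
    "c v w \<noteq> 0 \<Longrightarrow> v \<in> B" "c v w \<noteq> 0 \<Longrightarrow> w \<in> B" "c v w \<noteq> 0 \<Longrightarrow> v \<subset> w"
    "c v w \<noteq> 0 \<Longrightarrow> h w = Suc (h v)"
    "(\<Sum>v\<in>B. c u v * c v w) = 0"
    "P U \<Longrightarrow> z \<in> frame_chains B U \<Longrightarrow> (\<And>v. frame_diff B c z v = 0) \<Longrightarrow>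
        \<exists>y\<in>frame_chains B U. \<forall>v. frame_diff B c y v = z v"
  using assms unfolding frame_def by (blast, blast, blast, blast, blast, blast, blast, blast, blast, blast, blast, blast, blast)

text \<open>The differential lowers \<open>h\<close> by exactly one, so the components of a preimage
  outside degree \<open>Suc n\<close> do not affect the boundary in degree \<open>n\<close> and may
  be discarded.\<close>

lemma frame_exact_homogeneous:
  assumes F: "frame P B h c" and "P U" "z \<in> frame_chains B U" "\<And>v. frame_diff B c z v = 0"
    and hz: "\<And>w. z w \<noteq> 0 \<Longrightarrow> h w = n"
  shows "\<exists>y\<in>frame_chains B U. (\<forall>w. y w \<noteq> 0 \<longrightarrow> h w = Suc n) \<and> (\<forall>v. frame_diff B c y v = z v)"
proof -
  obtain y where y: "y \<in> frame_chains B U" "\<And>v. frame_diff B c y v = z v"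
    using frameD(13)[OF F assms(2,3,4)] by auto
  define y' where "y' w = (if h w = Suc n then y w else 0)" for w
  have "frame_diff B c y' v = z v" for v
  proof (cases "h v = n")
    case True
    have "frame_diff B c y' v = frame_diff B c y v"
      unfolding frame_diff_def y'_def
      by (rule sum.cong) (use True frameD(11)[OF F] in auto)
    then show ?thesis using y by simp
  next
    case False
    have "frame_diff B c y' v = 0"
      unfolding frame_diff_def
    proof (rule sum.neutral, rule ballI)
      show "c v w * y' w = 0" for w
        using False frameD(11)[OF F, of v w] by (cases "c v w = 0") (auto simp: y'_def)
    qed
    then show ?thesis using hz False by force
  qed
  moreover have "y' \<in> frame_chains B U" using y(1) unfolding frame_chains_def y'_def by auto
  ultimately show ?thesis by (intro bexI[of _ y']) (auto simp: y'_def split: if_splits)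
qed

text \<open>A nonempty basis element inside \<open>U\<close> would force \<open>P U\<close>. Hence
  outside the ideal only the generator \<open>{}\<close> survives, and its homology is R/I; this is
  why a frame demands exactness only where \<open>P U\<close> holds.\<close>

lemma frame_chains_trivial:
  assumes "frame P B h c" "\<not> P U" "z \<in> frame_chains B U" "w \<noteq> {}"
  shows "z w = 0"
  using assms frameD(1,6)[OF assms(1)] unfolding frame_chains_def by blast

text \<open>The hypothesis says that multiplication by the monomial of \<open>e\<close> carries the
  second ideal into the first; this is the comparison map covering that multiplication. The image of
  the boundary of \<open>w\<close> is a cycle in multidegree \<open>w \<union> e\<close>, where the
  first frame is exact, so values can be chosen one homological degree at a time.\<close>

lemma frame_lift:
  assumes F1: "frame P1 B1 h1 c1" and F2: "frame P2 B2 h2 c2"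
    and P: "\<And>w. P2 w \<Longrightarrow> P1 (w \<union> e)"
  shows "\<exists>\<phi>. \<forall>w\<in>B2. \<phi> w \<in> frame_chains B1 (w \<union> e) \<and> (w = {} \<longrightarrow> \<phi> w = (\<lambda>v. if v = {} then 1 else 0)) \<and>
     (\<forall>v. \<phi> w v \<noteq> 0 \<longrightarrow> h1 v = h2 w) \<and>
     (\<forall>u. (\<Sum>v\<in>B1. c1 u v * \<phi> w v) = (\<Sum>v\<in>B2. c2 v w * \<phi> v u))"
    (is "\<exists>\<phi>. \<forall>w\<in>B2. ?good \<phi> w")
proof -
  have "\<exists>\<phi>. \<forall>w\<in>B2. h2 w \<le> n \<longrightarrow> ?good \<phi> w" for n
  proof (induction n)
    case 0
    have "?good (\<lambda>w v. if v = {} then 1 else 0) w" if "w \<in> B2" "h2 w \<le> 0" for w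
    proof -
      have w: "w = {}" using frameD(7)[OF F2 that(1)] that(2) by auto
      have "c1 u {} = 0" "c2 u {} = 0" for u
        using frameD(10)[OF F1, of u "{}"] frameD(10)[OF F2, of u "{}"] by auto
      then show ?thesis using frameD(4,5)[OF F1] frameD(2,5)[OF F2] frameD(2)[OF F1]
        by (auto simp: w frame_chains_def if_distrib sum.delta cong: if_cong)
    qed
    then show ?case by (intro exI[of _ "\<lambda>w v. if v = {} then 1 else 0"]) blast
  next
    case (Suc n)
    then obtain \<phi> where \<phi>: "\<And>w. w \<in> B2 \<Longrightarrow> h2 w \<le> n \<Longrightarrow> ?good \<phi> w" by blast
    \<comment> \<open>The image of the boundary of \<open>w\<close> under the part already built;
      the value at \<open>w\<close> will be a preimage of this cycle.\<close>
    define r where "r w u = (\<Sum>v\<in>B2. c2 v w * \<phi> v u)" for w u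
    have "\<exists>y\<in>frame_chains B1 (w \<union> e). (\<forall>v. y v \<noteq> 0 \<longrightarrow> h1 v = Suc n) \<and> (\<forall>v. frame_diff B1 c1 y v = r w v)"
      if w: "w \<in> B2" "h2 w = Suc n" for w
    proof (rule frame_exact_homogeneous[OF F1])
      have "P2 w" using frameD(6)[OF F2 w(1)] w(2) frameD(5)[OF F2] by (cases "w = {}") auto
      then show "P1 (w \<union> e)" by (rule P)
      have *: "\<exists>v\<in>B2. c2 v w \<noteq> 0 \<and> \<phi> v u \<noteq> 0" if "r w u \<noteq> 0" for u
        using sum.not_neutral_contains_not_neutral[OF that[unfolded r_def]] by auto
      have **: "v \<in> B2" "h2 v = n" "v \<subset> w" if "c2 v w \<noteq> 0" for v
        using frameD(8,10,11)[OF F2 that] w by auto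
      show "r w \<in> frame_chains B1 (w \<union> e)"
        unfolding frame_chains_def using * ** \<phi> by (fastforce simp: frame_chains_def)
      show "h1 u = n" if "r w u \<noteq> 0" for u
        using *[OF that] ** \<phi> by (metis order_refl)
      show "frame_diff B1 c1 (r w) u = 0" for u
      proof -
        have "frame_diff B1 c1 (r w) u = (\<Sum>v\<in>B1. \<Sum>v'\<in>B2. c2 v' w * (c1 u v * \<phi> v' v))"
          unfolding frame_diff_def r_def sum_distrib_left by (simp add: ac_simps)
        also have "\<dots> = (\<Sum>v'\<in>B2. c2 v' w * (\<Sum>v\<in>B1. c1 u v * \<phi> v' v))"
          by (subst sum.swap) (simp add: sum_distrib_left)
        also have "\<dots> = (\<Sum>v'\<in>B2. c2 v' w * (\<Sum>v\<in>B2. c2 v v' * \<phi> v u))"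
        proof (rule sum.cong[OF refl])
          fix v' assume "v' \<in> B2"
          show "c2 v' w * (\<Sum>v\<in>B1. c1 u v * \<phi> v' v) = c2 v' w * (\<Sum>v\<in>B2. c2 v v' * \<phi> v u)"
            using \<phi>[OF \<open>v' \<in> B2\<close>] **(2)[of v'] by (cases "c2 v' w = 0") auto
        qed
        also have "\<dots> = (\<Sum>v\<in>B2. \<phi> v u * (\<Sum>v'\<in>B2. c2 v v' * c2 v' w))"
          unfolding sum_distrib_left by (subst sum.swap) (simp add: ac_simps)
        also have "\<dots> = 0" by (simp add: frameD(12)[OF F2])
        finally show ?thesis .
      qed
    qed
    then have "\<forall>w\<in>{w\<in>B2. h2 w = Suc n}. \<exists>y. y \<in> frame_chains B1 (w \<union> e) \<and> (\<forall>v. y v \<noteq> 0 \<longrightarrow> h1 v = Suc n) \<and> (\<forall>v. frame_diff B1 c1 y v = r w v)"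
      by blast
    from bchoice[OF this] obtain \<psi> where
      \<psi>: "\<And>w. w \<in> B2 \<Longrightarrow> h2 w = Suc n \<Longrightarrow> \<psi> w \<in> frame_chains B1 (w \<union> e) \<and> (\<forall>v. \<psi> w v \<noteq> 0 \<longrightarrow> h1 v = Suc n) \<and> (\<forall>v. frame_diff B1 c1 (\<psi> w) v = r w v)"
      by blast
    define \<phi>' where "\<phi>' w = (if h2 w = Suc n then \<psi> w else \<phi> w)" for w
    have eq: "(\<Sum>v\<in>B2. c2 v w * \<phi>' v u) = (\<Sum>v\<in>B2. c2 v w * \<phi> v u)" if "h2 w \<le> Suc n" for w u
    proof (rule sum.cong[OF refl])
      show "c2 v w * \<phi>' v u = c2 v w * \<phi> v u" for v
        using frameD(11)[OF F2, of v w] that by (cases "c2 v w = 0") (auto simp: \<phi>'_def)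
    qed
    have "?good \<phi>' w" if w: "w \<in> B2" "h2 w \<le> Suc n" for w
    proof (cases "h2 w = Suc n")
      case True
      then show ?thesis using \<psi>[OF w(1) True] eq[OF w(2)] frameD(5)[OF F2]
        by (auto simp: \<phi>'_def frame_diff_def r_def)
    next
      case False
      then have "h2 w \<le> n" using w by auto
      then show ?thesis using \<phi>[OF w(1)] eq[OF w(2)] False frameD(5)[OF F2] by (simp add: \<phi>'_def)
    qed
    then show ?case by blast
  qed
  \<comment> \<open>The maps obtained for different \<open>n\<close> need not extend one another. As
    \<open>B2\<close> is finite, the one for the largest homological degree covers all of
    it.\<close>
  from this[of "Max (h2 ` B2)"] obtain \<phi> where "\<forall>w\<in>B2. h2 w \<le> Max (h2 ` B2) \<longrightarrow> ?good \<phi> w" ..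
  moreover have "h2 w \<le> Max (h2 ` B2)" if "w \<in> B2" for w
    using that frameD(2)[OF F2] by simp
  ultimately show ?thesis by (intro exI[of _ \<phi>]) simp
qed

text \<open>
  The mapping cone for \<open>I + (e)\<close>, where \<open>P1\<close> belongs to \<open>I\<close> and \<open>P2\<close> to \<open>I : e\<close>. The last assumption
  makes it minimal.
\<close>

lemma frame_cone:
  fixes c1 c2 :: "'v set \<Rightarrow> 'v set \<Rightarrow> 'k::field"
  assumes F1: "frame P1 B1 h1 c1" and F2: "frame P2 B2 h2 c2"
    and fe: "finite e"
    and disj: "\<And>w. w \<in> B2 \<Longrightarrow> w \<inter> e = {}"
    and colon: "\<And>U. e \<subseteq> U \<Longrightarrow> P1 U \<longleftrightarrow> P2 U"
    and new: "\<And>w. w \<in> B2 \<Longrightarrow> w \<union> e \<notin> B1"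
  shows "\<exists>c :: 'v set \<Rightarrow> 'v set \<Rightarrow> 'k. frame (\<lambda>U. P1 U \<or> e \<subseteq> U) (B1 \<union> (\<lambda>w. w \<union> e) ` B2)
    (\<lambda>w. if w \<in> B1 then h1 w else Suc (h2 (w - e))) c"
proof -
  have "P1 (w \<union> e)" if "P2 w" for w
    using colon[of "w \<union> e"] frameD(1)[OF F2 that, of "w \<union> e"] by simp
  from frame_lift[OF F1 F2 this] obtain \<phi> where \<phi>: "\<forall>w\<in>B2. \<phi> w \<in> frame_chains B1 (w \<union> e) \<and>
     (w = {} \<longrightarrow> \<phi> w = (\<lambda>v. if v = {} then 1 else 0)) \<and> (\<forall>v. \<phi> w v \<noteq> 0 \<longrightarrow> h1 v = h2 w) \<and>
     (\<forall>u. (\<Sum>v\<in>B1. c1 u v * \<phi> w v) = (\<Sum>v\<in>B2. c2 v w * \<phi> v u))" ..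
  have \<phi>1: "v \<in> B1 \<and> v \<subseteq> w \<union> e \<and> h1 v = h2 w" if "w \<in> B2" "\<phi> w v \<noteq> 0" for w v
    using \<phi> that unfolding frame_chains_def mem_Collect_eq by meson
  have \<phi>0: "\<phi> {} = (\<lambda>v. if v = {} then 1 else 0)"
    using \<phi> frameD(4)[OF F2] by simp
  have \<phi>d: "(\<Sum>v\<in>B1. c1 u v * \<phi> w v) = (\<Sum>v\<in>B2. c2 v w * \<phi> v u)" if "w \<in> B2" for w u
    using \<phi> that by simp
  define E where "E = (\<lambda>w. w \<union> e) ` B2"
  define B where "B = B1 \<union> E"
  define h where "h w = (if w \<in> B1 then h1 w else Suc (h2 (w - e)))" for w
  \<comment> \<open>Block form of the cone differential: \<open>c1\<close> on the old basis, the
    comparison map from new to old, and \<open>- c2\<close> on the new part. The sign makes the two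
    mixed composites cancel.\<close>
  define c where "c v w = (if w \<in> B1 then c1 v w else if w \<in> E then
    (if v \<in> B1 then \<phi> (w - e) v else if v \<in> E then - c2 (v - e) (w - e) else 0) else 0)" for v w
  have fin: "finite B1" "finite B2" using frameD(2)[OF F1] frameD(2)[OF F2] by auto
  have me: "(w \<union> e) - e = w" if "w \<in> B2" for w using disj[OF that] by auto
  have inj: "inj_on (\<lambda>w. w \<union> e) B2" by (rule inj_onI) (metis me)
  have dis: "B1 \<inter> E = {}" using new by (auto simp: E_def)
  have inE: "w \<union> e \<in> E" if "w \<in> B2" for w using that by (auto simp: E_def)
  have split: "(\<Sum>w\<in>B. f w) = (\<Sum>w\<in>B1. f w) + (\<Sum>w\<in>B2. f (w \<union> e))" for f :: "'v set \<Rightarrow> 'k"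
    unfolding B_def by (subst sum.union_disjoint) (use fin dis in \<open>auto simp: E_def sum.reindex[OF inj]\<close>)
  have c11: "c v w = c1 v w" if "w \<in> B1" for v w using that by (simp add: c_def)
  have c12: "c v (w \<union> e) = \<phi> w v" if "w \<in> B2" "v \<in> B1" for v w
    using that new me inE by (simp add: c_def)
  have c22: "c (v \<union> e) (w \<union> e) = - c2 v w" if "w \<in> B2" "v \<in> B2" for v w
    using that new me inE by (simp add: c_def)
  have c21: "c (v \<union> e) w = 0" if "w \<in> B1" "v \<in> B2" for v w
    using that new[of v] frameD(8)[OF F1, of "v \<union> e" w] by (auto simp: c_def)
  have c0: "v \<in> B \<and> w \<in> B" if "c v w \<noteq> 0" for v w
    using that frameD(8)[OF F1] unfolding c_def B_def by (auto split: if_splits)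
  have hE: "h (w \<union> e) = Suc (h2 w)" if "w \<in> B2" for w using that new me by (simp add: h_def)
  have hB: "h w = h1 w" if "w \<in> B1" for w using that by (simp add: h_def)
  have cnz: "v \<subset> w \<and> h w = Suc (h v)" if cvw: "c v w \<noteq> 0" for v w
  proof -
    consider "w \<in> B1" | w2 where "w2 \<in> B2" "w = w2 \<union> e" "v \<in> B1" | w2 v2 where "w2 \<in> B2" "w = w2 \<union> e" "v2 \<in> B2" "v = v2 \<union> e"
      using c0[OF cvw] unfolding B_def E_def by blast
    then show ?thesis
    proof cases
      case 1
      then have "c1 v w \<noteq> 0" using cvw c11 by simp
      then show ?thesis using frameD(8-11)[OF F1] hB by metis
    next
      case 2
      then have "\<phi> w2 v \<noteq> 0" using cvw c12 by simp
      then show ?thesis using \<phi>1[OF 2(1)] 2 new hE hB by force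
    next
      case 3
      then have nz: "c2 v2 w2 \<noteq> 0" using cvw c22 by simp
      then have "v2 \<subset> w2" "h2 w2 = Suc (h2 v2)" using frameD(10,11)[OF F2] by auto
      then show ?thesis using 3 hE inj by (auto dest: inj_onD)
    qed
  qed
  have dd: "(\<Sum>v\<in>B. c u v * c v w) = 0" for u w
  proof (cases "u \<in> B \<and> w \<in> B")
    case False
    then have "c u v * c v w = 0" for v using c0[of u v] c0[of v w] by auto
    then show ?thesis by simp
  next
    case True
    consider "w \<in> B1" | w2 where "w2 \<in> B2" "w = w2 \<union> e" "u \<in> B1" | w2 u2 where "w2 \<in> B2" "w = w2 \<union> e" "u2 \<in> B2" "u = u2 \<union> e"
      using True unfolding B_def E_def by blast
    then show ?thesis
    proof cases
      case 1
      have "c1 (v \<union> e) w = 0" if "v \<in> B2" for v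
        using new[OF that] frameD(8)[OF F1] by blast
      then show ?thesis unfolding split using frameD(12)[OF F1] 1 by (simp add: c11)
    next
      case 2
      then show ?thesis unfolding split using \<phi>d[of w2 u]
        by (simp add: c11 c12 c22 sum_negf mult.commute)
    next
      case 3
      then show ?thesis unfolding split using frameD(12)[OF F2] by (simp add: c21 c22)
    qed
  qed
  have mono: "P1 V \<or> e \<subseteq> V" if "P1 U \<or> e \<subseteq> U" "U \<subseteq> V" for U V
    using that frameD(1)[OF F1] by blast
  have ex: "\<exists>y\<in>frame_chains B U. \<forall>v. frame_diff B c y v = z v"
    if PU: "P1 U \<or> e \<subseteq> U" and z: "z \<in> frame_chains B U" and dz: "\<And>v. frame_diff B c z v = 0" for U z
  proof -
    have d1: "frame_diff B c x v = frame_diff B1 c1 x v + (\<Sum>w\<in>B2. \<phi> w v * x (w \<union> e))"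
      if "v \<in> B1" for x v
      unfolding frame_diff_def split using that by (simp add: c11 c12)
    have d2: "frame_diff B c x (v \<union> e) = - frame_diff B2 c2 (\<lambda>w. x (w \<union> e)) v"
      if "v \<in> B2" for x v
      unfolding frame_diff_def split using that by (simp add: c21 c22 sum_negf)
    have d0: "frame_diff B c x v = 0" if "v \<notin> B" for x v
    proof -
      have "c v w = 0" for w using that c0 by blast
      then show ?thesis by (simp add: frame_diff_def)
    qed
    have d01: "frame_diff B1 c1 x v = 0" if "v \<notin> B1" for x v
    proof -
      have "c1 v w = 0" for w using that frameD(8)[OF F1] by blast
      then show ?thesis by (simp add: frame_diff_def)
    qed
    have d02: "frame_diff B2 c2 x v = 0" if "v \<notin> B2" for x v
    proof -
      have "c2 v w = 0" for w using that frameD(8)[OF F2] by blast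
      then show ?thesis by (simp add: frame_diff_def)
    qed
    define z1 where "z1 v = (if v \<in> B1 then z v else 0)" for v
    define z2 where "z2 v = (if v \<in> B2 then z (v \<union> e) else 0)" for v
    have z1: "z1 \<in> frame_chains B1 U" using z by (auto simp: frame_chains_def z1_def)
    have z2: "z2 \<in> frame_chains B2 U" using z by (auto simp: frame_chains_def z2_def)
    have zz1: "frame_diff B1 c1 z v = frame_diff B1 c1 z1 v" for v
      unfolding frame_diff_def by (simp add: z1_def)
    have zz2: "frame_diff B2 c2 (\<lambda>w. z (w \<union> e)) v = frame_diff B2 c2 z2 v" for v
      unfolding frame_diff_def by (simp add: z2_def)
    \<comment> \<open>Without \<open>e\<close>, only the first frame is present. With
      \<open>e\<close> and inside the first ideal, both frames are exact. With \<open>e\<close> but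
      outside that ideal, only \<open>{}\<close> and \<open>e\<close> survive, and the comparison
      map pairs them off.\<close>
    consider (a) "\<not> e \<subseteq> U" | (b) "e \<subseteq> U" "P1 U" | (c) "e \<subseteq> U" "\<not> P1 U" by blast
    then show ?thesis
    proof cases
      case a
      have zE: "z (w \<union> e) = 0" for w using a z unfolding frame_chains_def by blast
      have "frame_diff B1 c1 z1 v = 0" for v
        using dz[of v] d1[of v z] d01[of v z1] zz1[of v] by (cases "v \<in> B1") (auto simp: zE)
      moreover have "P1 U" using a PU by blast
      ultimately obtain y where y: "y \<in> frame_chains B1 U" "\<And>v. frame_diff B1 c1 y v = z1 v"
        using frameD(13)[OF F1 _ z1] by blast
      have yE: "y (w \<union> e) = 0" for w using a y unfolding frame_chains_def by blast
      have "frame_diff B c y v = z v" for v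
      proof -
        consider "v \<in> B1" | w where "w \<in> B2" "v = w \<union> e" | "v \<notin> B" unfolding B_def E_def by blast
        then show ?thesis
        proof cases
          case 1 then show ?thesis using d1[of v y] y(2)[of v] by (simp add: yE z1_def)
        next
          case 2 then show ?thesis using d2[of w y] by (simp add: yE zE frame_diff_def)
        next
          case 3 then show ?thesis using d0[of v y] z by (auto simp: frame_chains_def)
        qed
      qed
      moreover have "y \<in> frame_chains B U" using y(1) by (auto simp: frame_chains_def B_def)
      ultimately show ?thesis by blast
    next
      case b
      have P2U: "P2 U" using b colon by blast
      \<comment> \<open>The new part of the cone has differential \<open>- c2\<close>, so a preimage
        of \<open>z2\<close> there is a preimage of \<open>- z2\<close> under
        \<open>c2\<close>.\<close>
      define m where "m w = - z2 w" for w
      have m: "m \<in> frame_chains B2 U" using z2 by (auto simp: frame_chains_def m_def)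
      have dz2: "frame_diff B2 c2 z2 v = 0" for v
        using dz[of "v \<union> e"] d2[of v z] d02[of v z2] zz2[of v] by (cases "v \<in> B2") auto
      then have "frame_diff B2 c2 m v = 0" for v
        by (simp add: frame_diff_def m_def sum_negf)
      then obtain y2 where y2: "y2 \<in> frame_chains B2 U" "\<And>v. frame_diff B2 c2 y2 v = m v"
        using frameD(13)[OF F2 P2U m] by blast
      \<comment> \<open>Removing the contribution of \<open>y2\<close> to the old part leaves a
        cycle of the first frame: the chain map identity reduces this to the vanishing of the cone
        differential of \<open>z\<close>.\<close>
      define q where "q v = z1 v - (\<Sum>w\<in>B2. \<phi> w v * y2 w)" for v
      have q: "q \<in> frame_chains B1 U"
        unfolding frame_chains_def
      proof safe
        fix v assume "q v \<noteq> 0"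
        then have "z1 v \<noteq> 0 \<or> (\<exists>w\<in>B2. \<phi> w v \<noteq> 0 \<and> y2 w \<noteq> 0)"
          unfolding q_def by (force elim: sum.not_neutral_contains_not_neutral)
        then have *: "v \<in> B1 \<and> v \<subseteq> U"
        proof
          assume "z1 v \<noteq> 0" then show ?thesis using z1 by (auto simp: frame_chains_def)
        next
          assume "\<exists>w\<in>B2. \<phi> w v \<noteq> 0 \<and> y2 w \<noteq> 0"
          then obtain w where "w \<in> B2" "\<phi> w v \<noteq> 0" "y2 w \<noteq> 0" by blast
          then show ?thesis using \<phi>1[of w v] y2(1) b(1) unfolding frame_chains_def by blast
        qed
        show "v \<in> B1" using * by simp
        fix x assume "x \<in> v" then show "x \<in> U" using * by blast
      qed
      have "frame_diff B1 c1 q u = 0" for u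
      proof (cases "u \<in> B1")
        case False then show ?thesis by (rule d01)
      next
        case True
        have "frame_diff B1 c1 q u = frame_diff B1 c1 z1 u - (\<Sum>v\<in>B1. c1 u v * (\<Sum>w\<in>B2. \<phi> w v * y2 w))"
          unfolding frame_diff_def q_def by (simp add: right_diff_distrib sum_subtractf)
        also have "(\<Sum>v\<in>B1. c1 u v * (\<Sum>w\<in>B2. \<phi> w v * y2 w)) = (\<Sum>w\<in>B2. y2 w * (\<Sum>v\<in>B1. c1 u v * \<phi> w v))"
          unfolding sum_distrib_left by (subst sum.swap) (simp add: ac_simps)
        also have "\<dots> = (\<Sum>w\<in>B2. y2 w * (\<Sum>v\<in>B2. c2 v w * \<phi> v u))"
          using \<phi>d by (simp cong: sum.cong)
        also have "\<dots> = (\<Sum>v\<in>B2. \<phi> v u * frame_diff B2 c2 y2 v)"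
          unfolding frame_diff_def sum_distrib_left by (subst sum.swap) (simp add: ac_simps)
        also have "\<dots> = - (\<Sum>v\<in>B2. \<phi> v u * z (v \<union> e))"
          by (simp add: y2(2) m_def z2_def sum_negf)
        finally show ?thesis using d1[OF True, of z] dz[of u] zz1[of u] by simp
      qed
      then obtain y1 where y1: "y1 \<in> frame_chains B1 U" "\<And>v. frame_diff B1 c1 y1 v = q v"
        using frameD(13)[OF F1 b(2) q] by blast
      define y where "y w = (if w \<in> B1 then y1 w else if w \<in> E then y2 (w - e) else 0)" for w
      have yB: "y (w \<union> e) = y2 w" if "w \<in> B2" for w using that new me inE by (simp add: y_def)
      have e1: "frame_diff B1 c1 y v = frame_diff B1 c1 y1 v" for v
        unfolding frame_diff_def by (simp add: y_def)
      have e2: "frame_diff B2 c2 (\<lambda>w. y (w \<union> e)) v = frame_diff B2 c2 y2 v" for v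
        unfolding frame_diff_def by (simp add: yB)
      have "frame_diff B c y v = z v" for v
      proof -
        consider "v \<in> B1" | w where "w \<in> B2" "v = w \<union> e" | "v \<notin> B" unfolding B_def E_def by blast
        then show ?thesis
        proof cases
          case 1 then show ?thesis using d1[of v y] y1(2)[of v] e1[of v] by (simp add: q_def z1_def yB)
        next
          case 2 then show ?thesis using d2[of w y] e2[of w] y2(2)[of w] by (simp add: m_def z2_def)
        next
          case 3 then show ?thesis using d0[of v y] z by (auto simp: frame_chains_def)
        qed
      qed
      moreover have "y \<in> frame_chains B U"
      proof -
        have "w \<in> B \<and> w \<subseteq> U" if nz: "y w \<noteq> 0" for w
        proof (cases "w \<in> B1")
          case True then show ?thesis using y1(1) nz unfolding y_def frame_chains_def B_def by auto
        next
          case False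
          then obtain w2 where "w2 \<in> B2" "w = w2 \<union> e" using nz unfolding y_def E_def by (auto split: if_splits)
          then show ?thesis using yB[of w2] nz y2(1) b(1) inE unfolding frame_chains_def B_def by auto
        qed
        then show ?thesis unfolding frame_chains_def by blast
      qed
      ultimately show ?thesis by blast
    next
      case c
      have nP2: "\<not> P2 U" using c colon by blast
      have z10: "z1 w = 0" if "w \<noteq> {}" for w using frame_chains_trivial[OF F1 c(2) z1 that] .
      have z20: "z2 w = 0" if "w \<noteq> {}" for w using frame_chains_trivial[OF F2 nP2 z2 that] .
      have em: "{} \<in> B1" "{} \<in> B2" using frameD(4)[OF F1] frameD(4)[OF F2] by auto
      have s2: "(\<Sum>w\<in>B2. f w * (if w = {} then a else 0)) = f {} * a" for f and a :: 'k
        using fin em by (simp add: if_distrib sum.delta cong: if_cong)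
      have s1: "(\<Sum>w\<in>B1. f w * (if w = {} then a else 0)) = f {} * a" for f and a :: 'k
        using fin em by (simp add: if_distrib sum.delta cong: if_cong)
      have zz: "z1 = (\<lambda>w. if w = {} then z {} else 0)" using z10 em by (auto simp: z1_def fun_eq_iff)
      have zz': "z2 = (\<lambda>w. if w = {} then z e else 0)" using z20 em by (auto simp: z2_def fun_eq_iff)
      have c1e: "c1 v {} = 0" and c2e: "c2 v {} = 0" for v
        using frameD(10)[OF F1, of v "{}"] frameD(10)[OF F2, of v "{}"] by auto
      have "frame_diff B c z {} = frame_diff B1 c1 z1 {} + (\<Sum>w\<in>B2. \<phi> w {} * z2 w)"
        using d1[OF em(1), of z] by (simp add: z2_def zz1)
      also have "\<dots> = z e" unfolding zz zz' frame_diff_def s1 s2 by (simp add: c1e \<phi>0)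
      finally have ze: "z e = 0" using dz by simp
      \<comment> \<open>Because \<open>\<phi> {}\<close> is the unit at \<open>{}\<close>, the new
        basis element \<open>e\<close> has boundary \<open>{}\<close> with coefficient one.\<close>
      define y where "y w = (if w = e then z {} else 0)" for w
      have neB1: "e \<notin> B1" using new[OF em(2)] by simp
      have y1: "frame_diff B1 c1 y v = 0" for v
        unfolding frame_diff_def y_def using neB1 by (auto intro!: sum.neutral)
      have y2: "y (w \<union> e) = (if w = {} then z {} else 0)" if "w \<in> B2" for w
        using disj[OF that] unfolding y_def by auto
      have "frame_diff B c y v = z v" for v
      proof -
        consider "v \<in> B1" | w where "w \<in> B2" "v = w \<union> e" | "v \<notin> B" unfolding B_def E_def by blast
        then show ?thesis
        proof cases
          case 1
          have "z v = (if v = {} then z {} else 0)" using fun_cong[OF zz, of v] 1 by (simp add: z1_def)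
          then show ?thesis using d1[OF 1, of y] y1[of v] by (simp add: y2 s2 \<phi>0 cong: sum.cong)
        next
          case 2
          have "z (w \<union> e) = 0" using fun_cong[OF zz', of w] 2 ze by (simp add: z2_def)
          then show ?thesis using d2[OF 2(1), of y] 2 by (simp add: y2 s2 frame_diff_def c2e cong: sum.cong)
        next
          case 3 then show ?thesis using d0[of v y] z by (auto simp: frame_chains_def)
        qed
      qed
      moreover have "y \<in> frame_chains B U" using c inE[OF em(2)] by (auto simp: frame_chains_def y_def B_def)
      ultimately show ?thesis by blast
    qed
  qed
  have "frame (\<lambda>U. P1 U \<or> e \<subseteq> U) B h c"
    unfolding frame_def
  proof (intro conjI allI impI ballI)
    show "finite B" using fin by (simp add: B_def E_def)
    show "{} \<in> B" "h {} = 0" using frameD(4,5)[OF F1] by (auto simp: B_def h_def)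
    show "finite w" if "w \<in> B" for w
      using that frameD(3)[OF F1] frameD(3)[OF F2] fe by (auto simp: B_def E_def)
    show "P1 w \<or> e \<subseteq> w" if "w \<in> B" "w \<noteq> {}" for w
      using that frameD(6)[OF F1] by (auto simp: B_def E_def)
    show "0 < h w" if "w \<in> B" "w \<noteq> {}" for w
      using that frameD(7)[OF F1, of w] by (cases "w \<in> B1") (auto simp: B_def E_def hE hB)
    show "P1 V \<or> e \<subseteq> V" if "P1 U \<or> e \<subseteq> U" "U \<subseteq> V" for U V using mono[OF that] .
    show "v \<in> B" "w \<in> B" if "c v w \<noteq> 0" for v w using c0[OF that] by auto
    show "v \<subset> w" "h w = Suc (h v)" if "c v w \<noteq> 0" for v w using cnz[OF that] by auto
    show "(\<Sum>v\<in>B. c u v * c v w) = 0" for u w by (rule dd)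
    show "\<exists>y\<in>frame_chains B U. \<forall>v. frame_diff B c y v = z v"
      if "P1 U \<or> e \<subseteq> U" "z \<in> frame_chains B U" "\<forall>v. frame_diff B c z v = 0" for U z
      using ex[OF that(1,2)] that(3) by blast
  qed
  moreover have "h = (\<lambda>w. if w \<in> B1 then h1 w else Suc (h2 (w - e)))" by (simp add: h_def fun_eq_iff)
  ultimately show ?thesis unfolding B_def E_def by auto
qed

lemma frame_cong:
  assumes "frame P B h c" "\<And>w. w \<in> B \<Longrightarrow> h w = h' w"
  shows "frame P B h' c"
  using assms unfolding frame_def by (smt (verit, best))

lemma frame_trivial: "frame (\<lambda>_. False) {{}} (\<lambda>_. 0) (\<lambda>_ _. 0 :: 'k::field)"
  by (simp add: frame_def)

text \<open>A variable absent from all multidegrees is a nonzerodivisor modulo the ideal, so the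
  colon by it changes nothing and the frame is coned with itself. Iteration yields the tensor
  product with the Koszul complex on \<open>V\<close>.\<close>

lemma frame_add_vars:
  fixes c :: "'v set \<Rightarrow> 'v set \<Rightarrow> 'k::field"
  assumes "frame P B h c" "finite V" "\<And>w. w \<in> B \<Longrightarrow> w \<inter> V = {}"
  shows "\<exists>c' :: 'v set \<Rightarrow> 'v set \<Rightarrow> 'k. frame (\<lambda>U. P U \<or> V \<inter> U \<noteq> {}) {w \<union> s | w s. w \<in> B \<and> s \<subseteq> V}
    (\<lambda>w. h (w - V) + card (w \<inter> V)) c'"
  using assms(2,3)
proof (induction V rule: finite_induct)
  case empty
  then show ?case using assms(1) by auto
next
  case (insert v V)
  define BV where "BV = {w \<union> s | w s. w \<in> B \<and> s \<subseteq> V}"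
  define hV where "hV w = h (w - V) + card (w \<inter> V)" for w
  from insert obtain c' :: "'v set \<Rightarrow> 'v set \<Rightarrow> 'k" where
    F: "frame (\<lambda>U. P U \<or> V \<inter> U \<noteq> {}) BV hV c'" unfolding BV_def hV_def by blast
  have nv: "v \<notin> w" if "w \<in> BV" for w using that insert by (auto simp: BV_def)
  have "\<exists>c :: 'v set \<Rightarrow> 'v set \<Rightarrow> 'k. frame (\<lambda>U. (P U \<or> V \<inter> U \<noteq> {}) \<or> {v} \<subseteq> U) (BV \<union> (\<lambda>w. w \<union> {v}) ` BV)
    (\<lambda>w. if w \<in> BV then hV w else Suc (hV (w - {v}))) c"
    by (rule frame_cone[OF F F]) (use nv in auto)
  then obtain c2 :: "'v set \<Rightarrow> 'v set \<Rightarrow> 'k" where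
    F2: "frame (\<lambda>U. (P U \<or> V \<inter> U \<noteq> {}) \<or> {v} \<subseteq> U) (BV \<union> (\<lambda>w. w \<union> {v}) ` BV)
    (\<lambda>w. if w \<in> BV then hV w else Suc (hV (w - {v}))) c2" ..
  have P: "(\<lambda>U. (P U \<or> V \<inter> U \<noteq> {}) \<or> {v} \<subseteq> U) = (\<lambda>U. P U \<or> insert v V \<inter> U \<noteq> {})"
    by auto
  have B: "BV \<union> (\<lambda>w. w \<union> {v}) ` BV = {w \<union> s | w s. w \<in> B \<and> s \<subseteq> insert v V}" (is "?L = ?R")
  proof (intro subset_antisym subsetI)
    fix x assume "x \<in> ?L"
    then obtain w s where "w \<in> B" "s \<subseteq> V" "x = w \<union> s \<or> x = w \<union> (insert v s)" by (auto simp: BV_def)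
    then show "x \<in> ?R" by blast
  next
    fix x assume "x \<in> ?R"
    then obtain w s where x: "w \<in> B" "s \<subseteq> insert v V" "x = w \<union> s" by blast
    show "x \<in> ?L"
    proof (cases "v \<in> s")
      case True
      have "x = (w \<union> (s - {v})) \<union> {v}" "s - {v} \<subseteq> V" using x True by auto
      moreover have "w \<union> (s - {v}) \<in> BV" unfolding BV_def using x(1) \<open>s - {v} \<subseteq> V\<close> by blast
      ultimately show ?thesis by blast
    next
      case False
      then show ?thesis using x by (auto simp: BV_def)
    qed
  qed
  have "frame (\<lambda>U. P U \<or> insert v V \<inter> U \<noteq> {}) {w \<union> s | w s. w \<in> B \<and> s \<subseteq> insert v V}
    (\<lambda>w. h (w - insert v V) + card (w \<inter> insert v V)) c2"
  proof (rule frame_cong[OF F2[unfolded P B]])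
    fix w assume "w \<in> {w \<union> s | w s. w \<in> B \<and> s \<subseteq> insert v V}"
    then have "w \<in> BV \<union> (\<lambda>w. w \<union> {v}) ` BV" unfolding B .
    then consider "w \<in> BV" | w' where "w' \<in> BV" "w = insert v w'" "w \<notin> BV" using nv by auto
    then show "(if w \<in> BV then hV w else Suc (hV (w - {v}))) = h (w - insert v V) + card (w \<inter> insert v V)"
    proof cases
      case 1
      then show ?thesis using nv[OF 1] by (simp add: hV_def Diff_insert0)
    next
      case 2
      then have "w - {v} = w'" "w - insert v V = w' - V" "w \<inter> insert v V = insert v (w' \<inter> V)"
        using nv[OF 2(1)] insert(2) by auto
      then show ?thesis using 2 insert(1,2) by (simp add: hV_def)
    qed
  qed
  then show ?case by blast
qed

section \<open>Uniqueness of minimal graded free resolutions\<close>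

text \<open>Gaussian elimination, by induction on the equations: an equation that vanishes on
  \<open>S\<close> is dropped, and otherwise a pivot unknown \<open>b0\<close> is eliminated from
  the others.\<close>

lemma exists_nonzero_null_vector:
  fixes F :: "'a \<Rightarrow> 'b \<Rightarrow> 'k::field"
  assumes "finite T" "finite S" "card T < card S"
  shows "\<exists>x. (\<exists>b\<in>S. x b \<noteq> 0) \<and> (\<forall>a\<in>T. (\<Sum>b\<in>S. F a b * x b) = 0)"
  using assms
proof (induction T arbitrary: S F rule: finite_induct)
  case empty
  then have "S \<noteq> {}" by auto
  then show ?case by (intro exI[of _ "\<lambda>_. 1"]) auto
next
  case (insert a T)
  show ?case
  proof (cases "\<exists>b\<in>S. F a b \<noteq> 0")
    case False
    have "card T < card S" using insert by simp
    then obtain x where "\<exists>b\<in>S. x b \<noteq> 0" "\<forall>a\<in>T. (\<Sum>b\<in>S. F a b * x b) = 0"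
      using insert.IH[OF insert.prems(1), of F] by blast
    then show ?thesis using False by auto
  next
    case True
    then obtain b0 where b0: "b0 \<in> S" "F a b0 \<noteq> 0" by blast
    define S' where "S' = S - {b0}"
    have S': "finite S'" "card T < card S'" "b0 \<notin> S'"
      using insert b0 by (auto simp: S'_def card_Diff_singleton)
    obtain x where x: "\<exists>b\<in>S'. x b \<noteq> 0" "\<forall>t\<in>T. (\<Sum>b\<in>S'. (F t b - F t b0 * F a b / F a b0) * x b) = 0"
      using insert.IH[OF S'(1,2), of "\<lambda>t b. F t b - F t b0 * F a b / F a b0"] by blast
    define s where "s = (\<Sum>b\<in>S'. F a b * x b)"
    \<comment> \<open>The coordinate at the pivot is the one that equation \<open>a\<close>
      forces.\<close>
    define y where "y b = (if b = b0 then - s / F a b0 else x b)" for b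
    have sum_y: "(\<Sum>b\<in>S. F t b * y b) = (\<Sum>b\<in>S'. F t b * x b) - F t b0 * s / F a b0" for t
    proof -
      have "(\<Sum>b\<in>S. F t b * y b) = F t b0 * y b0 + (\<Sum>b\<in>S'. F t b * y b)"
        unfolding S'_def by (rule sum.remove) (use insert b0 in auto)
      also have "(\<Sum>b\<in>S'. F t b * y b) = (\<Sum>b\<in>S'. F t b * x b)"
        by (rule sum.cong) (use S' in \<open>auto simp: y_def\<close>)
      finally show ?thesis by (simp add: y_def)
    qed
    have "(\<Sum>b\<in>S. F t b * y b) = 0" if "t \<in> insert a T" for t
    proof (cases "t = a")
      case True
      then show ?thesis using b0 by (simp add: sum_y flip: s_def)
    next
      case False
      then have "(\<Sum>b\<in>S'. (F t b - F t b0 * F a b / F a b0) * x b) = 0" using x(2) that by auto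
      moreover have "(\<Sum>b\<in>S'. (F t b - F t b0 * F a b / F a b0) * x b) = (\<Sum>b\<in>S'. F t b * x b) - F t b0 * s / F a b0"
        by (simp add: left_diff_distrib sum_subtractf s_def sum_distrib_left sum_divide_distrib mult.assoc)
      ultimately show ?thesis using sum_y by simp
    qed
    moreover have "\<exists>b\<in>S. y b \<noteq> 0" using x(1) S' by (auto simp: y_def S'_def)
    ultimately show ?thesis by blast
  qed
qed

text \<open>Otherwise \<open>F\<close> kills some nonzero vector, which \<open>G\<close> would have
  to recover from zero.\<close>

lemma card_le_of_left_inverse:
  fixes F :: "'a \<Rightarrow> 'b \<Rightarrow> 'k::field"
  assumes "finite T" "finite S"
    and GF: "\<And>b c. b \<in> S \<Longrightarrow> c \<in> S \<Longrightarrow> (\<Sum>a\<in>T. G c a * F a b) = (if c = b then 1 else 0)"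
  shows "card S \<le> card T"
proof (rule ccontr)
  assume "\<not> card S \<le> card T"
  then obtain x b where x: "b \<in> S" "x b \<noteq> 0" "\<forall>a\<in>T. (\<Sum>b\<in>S. F a b * x b) = 0"
    using exists_nonzero_null_vector[of T S F] assms by auto
  have "x b = (\<Sum>c\<in>S. (if b = c then 1 else 0) * x c)"
    using x(1) assms(2) by (simp add: if_distrib[of "\<lambda>u. u * _"] sum.delta cong: if_cong)
  also have "\<dots> = (\<Sum>c\<in>S. (\<Sum>a\<in>T. G b a * F a c) * x c)"
    using GF x(1) by (intro sum.cong) auto
  also have "\<dots> = (\<Sum>a\<in>T. G b a * (\<Sum>c\<in>S. F a c * x c))"
    unfolding sum_distrib_left sum_distrib_right by (subst sum.swap) (simp add: mult.assoc)
  also have "\<dots> = 0" using x(3) by simp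
  finally show False using x(2) by simp
qed

section \<open>Homogeneous components and constant terms of polynomials\<close>

lemma monomial_degree_superset:
  assumes "finite K" "Poly_Mapping.keys m \<subseteq> K"
  shows "monomial_degree m = (\<Sum>v\<in>K. Poly_Mapping.lookup m v)"
  unfolding monomial_degree_def
  by (rule sum.mono_neutral_left) (use assms in \<open>auto simp: in_keys_iff\<close>)

lemma monomial_degree_add: "monomial_degree (m + n) = monomial_degree m + monomial_degree n"
proof -
  have "monomial_degree (m + n) = (\<Sum>v\<in>Poly_Mapping.keys m \<union> Poly_Mapping.keys n. Poly_Mapping.lookup (m + n) v)"
    by (rule monomial_degree_superset) (auto simp: keys_add)
  also have "\<dots> = monomial_degree m + monomial_degree n"
    by (subst (1 2) monomial_degree_superset[of "Poly_Mapping.keys m \<union> Poly_Mapping.keys n"])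
      (auto simp: lookup_add sum.distrib)
  finally show ?thesis .
qed

lemma monomial_degree_zero [simp]: "monomial_degree 0 = 0"
  by (simp add: monomial_degree_def)

lift_definition homogeneous_part ::
  "int \<Rightarrow> (('v \<Rightarrow>\<^sub>0 nat) \<Rightarrow>\<^sub>0 'k::zero) \<Rightarrow> ('v \<Rightarrow>\<^sub>0 nat) \<Rightarrow>\<^sub>0 'k" is
  "\<lambda>d f m. if int (monomial_degree m) = d then f m else 0"
  by (rule finite_subset) auto

lemma homogeneous_homogeneous_part: "homogeneous (homogeneous_part d f) d"
  unfolding homogeneous_def in_keys_iff by (transfer) auto

lemma homogeneous_part_add: "homogeneous_part d (f + g) = homogeneous_part d f + homogeneous_part d g"
  by (rule poly_mapping_eqI) (simp add: homogeneous_part.rep_eq lookup_add)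

lemma homogeneous_part_diff:
  fixes f g :: "('v, 'k::field) mpoly"
  shows "homogeneous_part d (f - g) = homogeneous_part d f - homogeneous_part d g"
  by (rule poly_mapping_eqI) (simp add: homogeneous_part.rep_eq lookup_minus)

lemma homogeneous_part_zero [simp]: "homogeneous_part d 0 = 0"
  by (rule poly_mapping_eqI) (simp add: homogeneous_part.rep_eq)

lemma homogeneous_part_sum: "homogeneous_part d (sum f A) = (\<Sum>x\<in>A. homogeneous_part d (f x))"
  by (induction A rule: infinite_finite_induct) (simp_all add: homogeneous_part_add)

lemma homogeneous_part_homogeneous: "homogeneous f d \<Longrightarrow> homogeneous_part d f = f"
  unfolding homogeneous_def
  by (rule poly_mapping_eqI) (auto simp: homogeneous_part.rep_eq in_keys_iff)

text \<open>Every monomial of \<open>g\<close> has degree \<open>d\<close>, so a product monomial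
  has degree \<open>n\<close> exactly when its factor from \<open>f\<close> has degree
  \<open>n - d\<close>.\<close>

lemma homogeneous_part_mult:
  fixes f g :: "('v, 'k::field) mpoly"
  assumes g: "homogeneous g d"
  shows "homogeneous_part n (g * f) = g * homogeneous_part (n - d) f"
proof (rule poly_mapping_eqI)
  fix m
  have *: "Poly_Mapping.lookup g l * (\<Sum>q. Poly_Mapping.lookup (homogeneous_part (n - d) f) q when m = l + q) =
    (if int (monomial_degree m) = n then Poly_Mapping.lookup g l * (\<Sum>q. Poly_Mapping.lookup f q when m = l + q) else 0)" for l
  proof (cases "Poly_Mapping.lookup g l = 0")
    case False
    then have l: "int (monomial_degree l) = d" using g by (auto simp: homogeneous_def in_keys_iff)
    have "(Poly_Mapping.lookup (homogeneous_part (n - d) f) q when m = l + q) =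
      (if int (monomial_degree m) = n then Poly_Mapping.lookup f q when m = l + q else 0)" for q
      using l by (auto simp: when_def homogeneous_part.rep_eq monomial_degree_add)
    then show ?thesis by simp
  qed simp
  have "Poly_Mapping.lookup (g * homogeneous_part (n - d) f) m =
    (if int (monomial_degree m) = n then Poly_Mapping.lookup (g * f) m else 0)"
    unfolding lookup_mult * by simp
  then show "Poly_Mapping.lookup (homogeneous_part n (g * f)) m = Poly_Mapping.lookup (g * homogeneous_part (n - d) f) m"
    by (simp add: homogeneous_part.rep_eq)
qed

lemma homogeneous_add:
  fixes f g :: "('v, 'k::field) mpoly"
  assumes "homogeneous f d" "homogeneous g d"
  shows "homogeneous (f + g) d"
  by (metis assms homogeneous_homogeneous_part homogeneous_part_add homogeneous_part_homogeneous)

lemma homogeneous_mult: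
  fixes f g :: "('v, 'k::field) mpoly"
  assumes "homogeneous f d" "homogeneous g d'" "d + d' = n"
  shows "homogeneous (f * g) n"
  using homogeneous_part_mult[OF assms(1), of n g] homogeneous_part_homogeneous[OF assms(2)]
    homogeneous_homogeneous_part[of n "f * g"] assms(3) by (auto simp: algebra_simps)

lemma homogeneous_zero [simp]: "homogeneous 0 d"
  by (simp add: homogeneous_def)

lemma homogeneous_sum:
  fixes f :: "'a \<Rightarrow> ('v, 'k::field) mpoly"
  shows "(\<And>x. x \<in> A \<Longrightarrow> homogeneous (f x) d) \<Longrightarrow> homogeneous (sum f A) d"
  by (induction A rule: infinite_finite_induct) (auto intro: homogeneous_add)

lemma constant_term_homogeneous:
  "homogeneous f d \<Longrightarrow> d \<noteq> 0 \<Longrightarrow> Poly_Mapping.lookup f 0 = 0"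
proof (rule ccontr)
  assume f: "homogeneous f d" and d: "d \<noteq> 0" and "Poly_Mapping.lookup f 0 \<noteq> 0"
  then have "0 \<in> Poly_Mapping.keys f" by (simp add: in_keys_iff)
  with f have "int (monomial_degree (0 :: 'a \<Rightarrow>\<^sub>0 nat)) = d" unfolding homogeneous_def by blast
  then show False using d by simp
qed

text \<open>Natural exponents add up to zero only if both vanish. Taking constant terms is thus the
  reduction modulo the ideal of all variables, through which minimality will be used.\<close>

lemma constant_term_mult:
  fixes f g :: "('v, 'k::field) mpoly"
  shows "Poly_Mapping.lookup (f * g) 0 = Poly_Mapping.lookup f 0 * Poly_Mapping.lookup g 0"
proof -
  have zero: "0 = l + q \<longleftrightarrow> l = 0 \<and> q = 0" for l q :: "'v \<Rightarrow>\<^sub>0 nat"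
    by (auto simp: poly_mapping_eq_iff fun_eq_iff lookup_add)
  have "(\<Sum>q. Poly_Mapping.lookup g q when 0 = l + q) = (Poly_Mapping.lookup g 0 when l = 0)" for l
    by (cases "l = 0") (simp_all add: zero)
  then show ?thesis by (simp add: lookup_mult mult_when)
qed

lemma constant_term_sum:
  "Poly_Mapping.lookup (sum f A) 0 = (\<Sum>x\<in>A. Poly_Mapping.lookup (f x) 0)"
  by (rule lookup_sum)

section \<open>Matrices between graded free modules\<close>

lemma mult_mat_entry:
  assumes "A \<in> carrier_mat n m" "B \<in> carrier_mat m k" "a < n" "b < k"
  shows "(A * B) $$ (a, b) = (\<Sum>c<m. A $$ (a, c) * B $$ (c, b))"
  using assms by (simp add: scalar_prod_def lessThan_atLeast0)

lemma mult_mat_vec_entry: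
  assumes "A \<in> carrier_mat n m" "v \<in> carrier_vec m" "a < n"
  shows "(A *\<^sub>v v) $ a = (\<Sum>c<m. A $$ (a, c) * v $ c)"
  using assms by (simp add: scalar_prod_def lessThan_atLeast0)

lemma graded_hom_mult:
  fixes A B :: "('v, 'k::field) mpoly mat"
  assumes A: "graded_hom ds1 ds0 A" and B: "graded_hom ds2 ds1 B"
  shows "graded_hom ds2 ds0 (A * B)"
proof -
  have cA: "A \<in> carrier_mat (length ds0) (length ds1)" and cB: "B \<in> carrier_mat (length ds1) (length ds2)"
    using A B by (auto simp: graded_hom_def)
  show ?thesis
    unfolding graded_hom_def
  proof (intro conjI allI impI)
    show "A * B \<in> carrier_mat (length ds0) (length ds2)" using cA cB by simp
    fix a b assume ab: "a < length ds0" "b < length ds2"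
    show "homogeneous ((A * B) $$ (a, b)) (ds2 ! b - ds0 ! a)"
      unfolding mult_mat_entry[OF cA cB ab]
      by (rule homogeneous_sum, rule homogeneous_mult) (use A B ab in \<open>auto simp: graded_hom_def\<close>)
  qed
qed

definition graded_part :: "int list \<Rightarrow> int list \<Rightarrow> ('v, 'k::field) mpoly mat \<Rightarrow> ('v, 'k) mpoly mat" where
  "graded_part ds ds' M = mat (length ds') (length ds) (\<lambda>(a, b). homogeneous_part (ds ! b - ds' ! a) (M $$ (a, b)))"

lemma graded_hom_graded_part: "graded_hom ds ds' (graded_part ds ds' M)"
  by (simp add: graded_hom_def graded_part_def homogeneous_homogeneous_part)

text \<open>Multiplication by \<open>A\<close> respects degrees, so the parts of \<open>h\<close> of
  wrong degree contribute nothing to a product that is itself of degree 0. Any lift may therefore be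
  replaced by a graded one.\<close>

lemma mult_graded_part:
  assumes A: "graded_hom ds1 ds0 A" and h: "h \<in> carrier_mat (length ds1) (length ds2)"
    and N: "graded_hom ds2 ds0 (A * h)"
  shows "A * h = A * graded_part ds2 ds1 h"
proof -
  have cA: "A \<in> carrier_mat (length ds0) (length ds1)" using A by (auto simp: graded_hom_def)
  have ch: "graded_part ds2 ds1 h \<in> carrier_mat (length ds1) (length ds2)" by (simp add: graded_part_def)
  show ?thesis
  proof (rule eq_matI)
    fix a b assume "a < dim_row (A * graded_part ds2 ds1 h)" "b < dim_col (A * graded_part ds2 ds1 h)"
    then have ab: "a < length ds0" "b < length ds2" using cA by (auto simp: graded_part_def)
    have "(A * h) $$ (a, b) = homogeneous_part (ds2 ! b - ds0 ! a) ((A * h) $$ (a, b))"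
      using N ab by (simp add: graded_hom_def homogeneous_part_homogeneous)
    also have "\<dots> = (\<Sum>c<length ds1. A $$ (a, c) * homogeneous_part (ds2 ! b - ds1 ! c) (h $$ (c, b)))"
      unfolding mult_mat_entry[OF cA h ab] homogeneous_part_sum
    proof (rule sum.cong[OF refl])
      fix c assume "c \<in> {..<length ds1}"
      then have "homogeneous (A $$ (a, c)) (ds1 ! c - ds0 ! a)" using A ab by (auto simp: graded_hom_def)
      from homogeneous_part_mult[OF this, of "ds2 ! b - ds0 ! a" "h $$ (c, b)"]
      show "homogeneous_part (ds2 ! b - ds0 ! a) (A $$ (a, c) * h $$ (c, b)) =
        A $$ (a, c) * homogeneous_part (ds2 ! b - ds1 ! c) (h $$ (c, b))" by simp
    qed
    also have "\<dots> = (A * graded_part ds2 ds1 h) $$ (a, b)"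
      unfolding mult_mat_entry[OF cA ch ab] using ab by (simp add: graded_part_def)
    finally show "(A * h) $$ (a, b) = (A * graded_part ds2 ds1 h) $$ (a, b)" .
  qed (use h in \<open>simp_all add: graded_part_def\<close>)
qed

text \<open>Projectivity of free modules: a preimage is chosen for each column.\<close>

lemma factor_through_image:
  assumes A: "A \<in> carrier_mat n m" and N: "N \<in> carrier_mat n k"
    and im: "\<And>b. b < k \<Longrightarrow> col N b \<in> mat_image A"
  shows "\<exists>h \<in> carrier_mat m k. N = A * h"
proof -
  have "\<forall>b\<in>{..<k}. \<exists>v. v \<in> carrier_vec m \<and> A *\<^sub>v v = col N b"
    using im A unfolding mat_image_def by (metis carrier_matD(2) imageE lessThan_iff)
  from bchoice[OF this] obtain v where v: "\<And>b. b < k \<Longrightarrow> v b \<in> carrier_vec m \<and> A *\<^sub>v v b = col N b"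
    by blast
  define h where "h = mat m k (\<lambda>(i, j). v j $ i)"
  have h: "h \<in> carrier_mat m k" by (simp add: h_def)
  have "N = A * h"
  proof (rule eq_matI)
    fix a b assume "a < dim_row (A * h)" "b < dim_col (A * h)"
    then have ab: "a < n" "b < k" using A h by auto
    have "(A * h) $$ (a, b) = (\<Sum>c<m. A $$ (a, c) * v b $ c)"
      unfolding mult_mat_entry[OF A h ab] using ab by (simp add: h_def)
    also have "\<dots> = (A *\<^sub>v v b) $ a" using mult_mat_vec_entry[OF A _ ab(1), of "v b"] v[OF ab(2)] by simp
    also have "\<dots> = N $$ (a, b)" using v[OF ab(2)] N ab by simp
    finally show "N $$ (a, b) = (A * h) $$ (a, b)" by simp
  qed (use A N h in auto)
  then show ?thesis using h by blast
qed

section \<open>Homogeneous ideals and comparison maps between resolutions\<close>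

definition homogeneous_ideal :: "('v, 'k::field) mpoly set \<Rightarrow> bool" where
  "homogeneous_ideal I \<longleftrightarrow> 0 \<in> I \<and> (\<forall>f\<in>I. \<forall>g\<in>I. f + g \<in> I) \<and> (\<forall>f\<in>I. \<forall>g. f * g \<in> I) \<and>
     (\<forall>f\<in>I. \<forall>d. homogeneous_part d f \<in> I)"

lemma homogeneous_idealD:
  assumes "homogeneous_ideal I"
  shows "0 \<in> I" "f \<in> I \<Longrightarrow> g \<in> I \<Longrightarrow> f + g \<in> I" "f \<in> I \<Longrightarrow> f * g \<in> I" "f \<in> I \<Longrightarrow> homogeneous_part d f \<in> I"
    "f \<in> I \<Longrightarrow> - f \<in> I" "f \<in> I \<Longrightarrow> g \<in> I \<Longrightarrow> f - g \<in> I"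
proof -
  show *: "0 \<in> I" "\<And>f g. f \<in> I \<Longrightarrow> g \<in> I \<Longrightarrow> f + g \<in> I" "\<And>f g. f \<in> I \<Longrightarrow> f * g \<in> I" "\<And>f d. f \<in> I \<Longrightarrow> homogeneous_part d f \<in> I"
    using assms unfolding homogeneous_ideal_def by blast+
  show neg: "- f \<in> I" if "f \<in> I" for f using *(3)[OF that, of "-1"] by simp
  show "f - g \<in> I" if "f \<in> I" "g \<in> I" for f g using *(2)[OF that(1) neg[OF that(2)]] by simp
qed

lemma homogeneous_ideal_sum:
  assumes "homogeneous_ideal I"
  shows "(\<And>x. x \<in> A \<Longrightarrow> f x \<in> I) \<Longrightarrow> sum f A \<in> I"
  by (induction A rule: infinite_finite_induct) (auto intro: homogeneous_idealD[OF assms])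

text \<open>The kernel of the augmentation and the kernels of the differentials are put under one
  name, so that exactness at every place becomes the single equation with
  \<open>mat_image (A i)\<close>.\<close>

definition cycles :: "('v, 'k::field) mpoly set \<Rightarrow> (nat \<Rightarrow> int list) \<Rightarrow> (nat \<Rightarrow> ('v, 'k) mpoly mat) \<Rightarrow>
    ('v, 'k) mpoly vec \<Rightarrow> nat \<Rightarrow> ('v, 'k) mpoly vec set" where
  "cycles I ds A e i = (case i of 0 \<Rightarrow> {v \<in> carrier_vec (length (ds 0)). e \<bullet> v \<in> I} | Suc j \<Rightarrow> mat_kernel (A j))"

lemma resolutionD:
  assumes "graded_free_resolution I ds A e"
  shows "graded_hom (ds (Suc i)) (ds i) (A i)" "A i \<in> carrier_mat (length (ds i)) (length (ds (Suc i)))"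
    "e \<in> carrier_vec (length (ds 0))" "b < length (ds 0) \<Longrightarrow> homogeneous (e $ b) (ds 0 ! b)"
    "\<exists>v\<in>carrier_vec (length (ds 0)). f - e \<bullet> v \<in> I"
    "cycles I ds A e i = mat_image (A i)"
  using assms unfolding graded_free_resolution_def graded_hom_def cycles_def by (auto split: nat.split)

lemma mult_in_image:
  "A \<in> carrier_mat n m \<Longrightarrow> v \<in> carrier_vec m \<Longrightarrow> A *\<^sub>v v \<in> mat_image A"
  by (auto simp: mat_image_def)

lemma col_in_image:
  fixes A :: "'a::comm_ring_1 mat"
  assumes "A \<in> carrier_mat n m" "b < m"
  shows "col A b \<in> mat_image A"
proof -
  have "A *\<^sub>v unit_vec m b = col A b"
    using assms by (intro eq_vecI) (auto)
  then show ?thesis using mult_in_image[OF assms(1), of "unit_vec m b"] by simp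
qed

text \<open>Each \<open>e $ b\<close> is hit by the other augmentation modulo \<open>I\<close>.
  Passing to components of the right degree preserves this because \<open>I\<close> is
  homogeneous.\<close>

lemma resolution_lift_start:
  fixes I :: "('v, 'k::field) mpoly set"
  assumes I: "homogeneous_ideal I"
    and R: "graded_free_resolution I ds A e" and R': "graded_free_resolution I ds' A' e'"
  shows "\<exists>F. graded_hom (ds 0) (ds' 0) F \<and> (\<forall>v\<in>carrier_vec (length (ds 0)). e \<bullet> v - e' \<bullet> (F *\<^sub>v v) \<in> I)"
proof -
  let ?n = "length (ds 0)" and ?n' = "length (ds' 0)"
  have "\<forall>b. \<exists>x. x \<in> carrier_vec ?n' \<and> e $ b - e' \<bullet> x \<in> I"
    using resolutionD(5)[OF R'] by blast
  from choice[OF this] obtain v where v: "\<And>b. v b \<in> carrier_vec ?n'" "\<And>b. e $ b - e' \<bullet> v b \<in> I"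
    by blast
  define F where "F = mat ?n' ?n (\<lambda>(a, b). homogeneous_part (ds 0 ! b - ds' 0 ! a) (v b $ a))"
  have cF: "F \<in> carrier_mat ?n' ?n" by (simp add: F_def)
  have col: "e $ b - (\<Sum>a<?n'. e' $ a * F $$ (a, b)) \<in> I" if b: "b < ?n" for b
  proof -
    have "homogeneous_part (ds 0 ! b) (e' \<bullet> v b) = (\<Sum>a<?n'. e' $ a * F $$ (a, b))"
      unfolding scalar_prod_def homogeneous_part_sum
    proof (rule sum.cong)
      show "{0..<dim_vec (v b)} = {..<?n'}" using v(1)[of b] by auto
      fix a assume a: "a \<in> {..<?n'}"
      then show "homogeneous_part (ds 0 ! b) (e' $ a * v b $ a) = e' $ a * F $$ (a, b)"
        using homogeneous_part_mult[OF resolutionD(4)[OF R', of a]] b by (simp add: F_def)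
    qed
    then show ?thesis
      using homogeneous_idealD(4)[OF I v(2)[of b], of "ds 0 ! b"] homogeneous_part_homogeneous[OF resolutionD(4)[OF R b]]
      by (simp add: homogeneous_part_diff)
  qed
  have "e \<bullet> x - e' \<bullet> (F *\<^sub>v x) \<in> I" if x: "x \<in> carrier_vec ?n" for x
  proof -
    have "e' \<bullet> (F *\<^sub>v x) = (\<Sum>a<?n'. e' $ a * (\<Sum>b<?n. F $$ (a, b) * x $ b))"
      unfolding scalar_prod_def using cF mult_mat_vec_entry[OF cF x] by (simp add: lessThan_atLeast0)
    also have "\<dots> = (\<Sum>b<?n. (\<Sum>a<?n'. e' $ a * F $$ (a, b)) * x $ b)"
      unfolding sum_distrib_left sum_distrib_right by (subst sum.swap) (simp add: mult.assoc)
    finally have "e \<bullet> x - e' \<bullet> (F *\<^sub>v x) = (\<Sum>b<?n. (e $ b - (\<Sum>a<?n'. e' $ a * F $$ (a, b))) * x $ b)"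
      using x by (simp add: scalar_prod_def lessThan_atLeast0 left_diff_distrib sum_subtractf)
    also have "\<dots> \<in> I"
      by (intro homogeneous_ideal_sum[OF I] homogeneous_idealD(3)[OF I] col) auto
    finally show ?thesis .
  qed
  moreover have "graded_hom (ds 0) (ds' 0) F"
    by (simp add: graded_hom_def F_def homogeneous_homogeneous_part)
  ultimately show ?thesis by blast
qed

text \<open>The comparison theorem: exactness of the second resolution supplies the next map, and
  its graded part is again a lift.\<close>

lemma resolution_lift:
  fixes I :: "('v, 'k::field) mpoly set"
  assumes I: "homogeneous_ideal I"
    and R: "graded_free_resolution I ds A e" and R': "graded_free_resolution I ds' A' e'"
  shows "\<exists>f. (\<forall>i. graded_hom (ds i) (ds' i) (f i)) \<and> (\<forall>i. f i * A i = A' i * f (Suc i)) \<and>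
    (\<forall>v\<in>carrier_vec (length (ds 0)). e \<bullet> v - e' \<bullet> (f 0 *\<^sub>v v) \<in> I)"
proof -
  \<comment> \<open>Preservation of cycles is kept in the invariant because it places the columns of
    \<open>F * A i\<close> in the image of \<open>A' i\<close>.\<close>
  define P where "P i F \<longleftrightarrow> graded_hom (ds i) (ds' i) F \<and> (\<forall>v\<in>cycles I ds A e i. F *\<^sub>v v \<in> cycles I ds' A' e' i) \<and>
    (i = 0 \<longrightarrow> (\<forall>v\<in>carrier_vec (length (ds 0)). e \<bullet> v - e' \<bullet> (F *\<^sub>v v) \<in> I))" for i F
  have base: "\<exists>F. P 0 F"
  proof -
    obtain F where F: "graded_hom (ds 0) (ds' 0) F" "\<And>v. v\<in>carrier_vec (length (ds 0)) \<Longrightarrow> e \<bullet> v - e' \<bullet> (F *\<^sub>v v) \<in> I"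
      using resolution_lift_start[OF I R R'] by blast
    have cF: "F \<in> carrier_mat (length (ds' 0)) (length (ds 0))" using F(1) by (simp add: graded_hom_def)
    have "F *\<^sub>v v \<in> cycles I ds' A' e' 0" if "v \<in> cycles I ds A e 0" for v
    proof -
      have v: "v \<in> carrier_vec (length (ds 0))" "e \<bullet> v \<in> I" using that by (auto simp: cycles_def)
      have "e \<bullet> v - (e \<bullet> v - e' \<bullet> (F *\<^sub>v v)) \<in> I" by (intro homogeneous_idealD(6)[OF I] v F)
      then show ?thesis using cF v by (auto simp: cycles_def)
    qed
    then show ?thesis using F unfolding P_def by blast
  qed
  have step: "\<exists>F'. P (Suc i) F' \<and> F * A i = A' i * F'" if PF: "P i F" for i F
  proof -
    have gF: "graded_hom (ds i) (ds' i) F" and cy: "\<And>v. v \<in> cycles I ds A e i \<Longrightarrow> F *\<^sub>v v \<in> cycles I ds' A' e' i"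
      using PF unfolding P_def by auto
    have cF: "F \<in> carrier_mat (length (ds' i)) (length (ds i))" using gF by (simp add: graded_hom_def)
    note cA = resolutionD(2)[OF R, of i] and cA' = resolutionD(2)[OF R', of i]
    have "\<exists>h\<in>carrier_mat (length (ds' (Suc i))) (length (ds (Suc i))). F * A i = A' i * h"
    proof (rule factor_through_image[OF cA'])
      show "F * A i \<in> carrier_mat (length (ds' i)) (length (ds (Suc i)))" using cF cA by simp
      fix b assume b: "b < length (ds (Suc i))"
      have "F *\<^sub>v col (A i) b \<in> mat_image (A' i)"
        using cy[of "col (A i) b"] col_in_image[OF cA b] resolutionD(6)[OF R, of i] resolutionD(6)[OF R', of i] by simp
      moreover have "col (F * A i) b = F *\<^sub>v col (A i) b"
        using cF cA b by (intro eq_vecI) auto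
      ultimately show "col (F * A i) b \<in> mat_image (A' i)" by simp
    qed
    then obtain h where h: "h \<in> carrier_mat (length (ds' (Suc i))) (length (ds (Suc i)))" "F * A i = A' i * h" by blast
    define F' where "F' = graded_part (ds (Suc i)) (ds' (Suc i)) h"
    have gF': "graded_hom (ds (Suc i)) (ds' (Suc i)) F'" unfolding F'_def by (rule graded_hom_graded_part)
    have cF': "F' \<in> carrier_mat (length (ds' (Suc i))) (length (ds (Suc i)))" using gF' by (simp add: graded_hom_def)
    have "graded_hom (ds (Suc i)) (ds' i) (A' i * h)"
      using graded_hom_mult[OF gF resolutionD(1)[OF R]] h(2) by simp
    from mult_graded_part[OF resolutionD(1)[OF R'] h(1) this] have eq: "F * A i = A' i * F'"
      unfolding F'_def using h(2) by simp
    have "F' *\<^sub>v v \<in> cycles I ds' A' e' (Suc i)" if "v \<in> cycles I ds A e (Suc i)" for v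
    proof -
      have v: "v \<in> carrier_vec (length (ds (Suc i)))" "A i *\<^sub>v v = 0\<^sub>v (length (ds i))"
        using that mat_kernelD[OF cA] by (auto simp: cycles_def)
      have "A' i *\<^sub>v (F' *\<^sub>v v) = (A' i * F') *\<^sub>v v" using cA' cF' v by simp
      also have "\<dots> = F *\<^sub>v (A i *\<^sub>v v)" unfolding eq[symmetric] using cF cA v by simp
      also have "\<dots> = 0\<^sub>v (length (ds' i))" unfolding v(2) using cF by (intro eq_vecI) (auto simp: scalar_prod_def)
      finally show ?thesis unfolding cycles_def using mat_kernelI[OF cA', of "F' *\<^sub>v v"] cF' v by simp
    qed
    then show ?thesis using gF' eq unfolding P_def by auto
  qed
  have "\<exists>f. \<forall>i. P i (f i) \<and> f i * A i = A' i * f (Suc i)"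
    by (rule dependent_nat_choice[of P "\<lambda>i F F'. F * A i = A' i * F'"]) (use base step in auto)
  then show ?thesis unfolding P_def by blast
qed

section \<open>Minimality and the invariance of generator degrees\<close>

definition no_constant_terms :: "('v, 'k::field) mpoly mat \<Rightarrow> bool" where
  "no_constant_terms M \<longleftrightarrow> (\<forall>a<dim_row M. \<forall>b<dim_col M. Poly_Mapping.lookup (M $$ (a, b)) 0 = 0)"

lemma no_constant_terms_mult:
  assumes "A \<in> carrier_mat n m" "B \<in> carrier_mat m k" "no_constant_terms A \<or> no_constant_terms B"
  shows "no_constant_terms (A * B)"
  unfolding no_constant_terms_def
proof (intro allI impI)
  fix a b assume "a < dim_row (A * B)" "b < dim_col (A * B)"
  then have ab: "a < n" "b < k" using assms by auto
  show "Poly_Mapping.lookup ((A * B) $$ (a, b)) 0 = 0"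
    unfolding mult_mat_entry[OF assms(1,2) ab] constant_term_sum constant_term_mult
    by (rule sum.neutral) (use assms ab in \<open>auto simp: no_constant_terms_def\<close>)
qed

lemma no_constant_terms_add:
  assumes "A \<in> carrier_mat n m" "B \<in> carrier_mat n m" "no_constant_terms A" "no_constant_terms B"
  shows "no_constant_terms (A + B)"
  using assms by (auto simp: no_constant_terms_def lookup_add)

text \<open>
  A chain endomorphism \<open>\<phi>\<close> inducing zero on \<open>R/I\<close> is null-homotopic. The induction keeps only the
  consequence \<open>\<phi>\<^sub>i A\<^sub>i = A\<^sub>i h A\<^sub>i\<close> of the homotopy.
\<close>

lemma minimal_null_homotopic:
  fixes I :: "('v, 'k::field) mpoly set"
  assumes M: "minimal_graded_free_resolution I ds A e"
    and \<phi>: "\<And>i. \<phi> i \<in> carrier_mat (length (ds i)) (length (ds i))"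
    and chain: "\<And>i. \<phi> i * A i = A i * \<phi> (Suc i)"
    and start: "\<And>v. v \<in> carrier_vec (length (ds 0)) \<Longrightarrow> e \<bullet> (\<phi> 0 *\<^sub>v v) \<in> I"
  shows "no_constant_terms (\<phi> i)"
proof -
  have R: "graded_free_resolution I ds A e" using M by (simp add: minimal_graded_free_resolution_def)
  note cA = resolutionD(2)[OF R]
  have nA: "no_constant_terms (A i)" for i
    using M cA[of i] unfolding minimal_graded_free_resolution_def no_constant_terms_def by auto
  have "\<exists>h\<in>carrier_mat (length (ds (Suc i))) (length (ds i)). \<phi> i * A i = A i * h * A i \<and> no_constant_terms (\<phi> i)"
  proof (induction i)
    case 0
    have "\<exists>h\<in>carrier_mat (length (ds (Suc 0))) (length (ds 0)). \<phi> 0 = A 0 * h"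
    proof (rule factor_through_image[OF cA \<phi>])
      fix b assume b: "b < length (ds 0)"
      have "col (\<phi> 0) b = \<phi> 0 *\<^sub>v unit_vec (length (ds 0)) b"
        using \<phi>[of 0] b by (intro eq_vecI) auto
      then have "col (\<phi> 0) b \<in> cycles I ds A e 0"
        using start[of "unit_vec (length (ds 0)) b"] \<phi>[of 0] by (simp add: cycles_def)
      then show "col (\<phi> 0) b \<in> mat_image (A 0)" using resolutionD(6)[OF R, of 0] by simp
    qed
    then obtain h where h: "h \<in> carrier_mat (length (ds (Suc 0))) (length (ds 0))" "\<phi> 0 = A 0 * h" by blast
    then show ?case using no_constant_terms_mult[OF cA h(1)] nA by metis
  next
    case (Suc i)
    then obtain h where h: "h\<in>carrier_mat (length (ds (Suc i))) (length (ds i))" "\<phi> i * A i = A i * h * A i" by blast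
    let ?n = "length (ds (Suc i))"
    note c0 = cA[of i] and c1 = cA[of "Suc i"] and p1 = \<phi>[of "Suc i"]
    have hA: "h * A i \<in> carrier_mat ?n ?n" using h c0 by simp
    have AA: "A i * A (Suc i) = 0\<^sub>m (length (ds i)) (length (ds (Suc (Suc i))))"
    proof (rule mat_col_eqI)
      fix b assume "b < dim_col (0\<^sub>m (length (ds i)) (length (ds (Suc (Suc i)))))"
      then have b: "b < length (ds (Suc (Suc i)))" by simp
      have "col (A (Suc i)) b \<in> mat_kernel (A i)"
        using col_in_image[OF c1 b] resolutionD(6)[OF R, of "Suc i"] by (simp add: cycles_def)
      then have "A i *\<^sub>v col (A (Suc i)) b = 0\<^sub>v (length (ds i))" using mat_kernelD[OF c0] by blast
      moreover have "col (A i * A (Suc i)) b = A i *\<^sub>v col (A (Suc i)) b"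
        using c0 c1 b by (intro eq_vecI) auto
      ultimately show "col (A i * A (Suc i)) b = col (0\<^sub>m (length (ds i)) (length (ds (Suc (Suc i))))) b"
        using b by simp
    qed (use c0 c1 in auto)
    \<comment> \<open>The chain condition and the induction hypothesis show that \<open>A i\<close>
      kills \<open>\<phi> (Suc i) - h * A i\<close>, so exactness yields the next homotopy
      \<open>g\<close>.\<close>
    have "\<exists>g\<in>carrier_mat (length (ds (Suc (Suc i)))) ?n. \<phi> (Suc i) - h * A i = A (Suc i) * g"
    proof (rule factor_through_image[OF c1])
      show "\<phi> (Suc i) - h * A i \<in> carrier_mat ?n ?n" using hA by (rule minus_carrier_mat)
      fix b assume b: "b < ?n"
      have "A i * (\<phi> (Suc i) - h * A i) = A i * \<phi> (Suc i) - A i * (h * A i)"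
        using c0 p1 hA by (rule mult_minus_distrib_mat)
      also have "\<dots> = 0\<^sub>m (length (ds i)) ?n"
        using chain[of i] h(2) assoc_mult_mat[OF c0 h(1) c0] c0 p1 hA h(1) by simp
      finally have z: "A i * (\<phi> (Suc i) - h * A i) = 0\<^sub>m (length (ds i)) ?n" .
      have "A i *\<^sub>v col (\<phi> (Suc i) - h * A i) b = col (A i * (\<phi> (Suc i) - h * A i)) b"
        using c0 p1 hA b by (intro eq_vecI) auto
      then have "A i *\<^sub>v col (\<phi> (Suc i) - h * A i) b = 0\<^sub>v (length (ds i))" unfolding z using b by simp
      moreover have "col (\<phi> (Suc i) - h * A i) b \<in> carrier_vec ?n"
        by (rule carrier_vecI) (use h(1) in simp)
      ultimately have "col (\<phi> (Suc i) - h * A i) b \<in> mat_kernel (A i)"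
        by (intro mat_kernelI[OF c0])
      then show "col (\<phi> (Suc i) - h * A i) b \<in> mat_image (A (Suc i))"
        using resolutionD(6)[OF R, of "Suc i"] by (simp add: cycles_def)
    qed
    then obtain g where g: "g \<in> carrier_mat (length (ds (Suc (Suc i)))) ?n" "\<phi> (Suc i) - h * A i = A (Suc i) * g" by blast
    have cg: "A (Suc i) * g \<in> carrier_mat ?n ?n" using c1 g(1) by simp
    \<comment> \<open>Each summand contains a differential, so minimality excludes constant terms.
      Multiplication by \<open>A (Suc i)\<close> kills the second summand, which restores the
      invariant.\<close>
    have eq: "\<phi> (Suc i) = A (Suc i) * g + h * A i"
      unfolding g(2)[symmetric] using p1 hA by (intro eq_matI) auto
    have "\<phi> (Suc i) * A (Suc i) = A (Suc i) * g * A (Suc i) + h * A i * A (Suc i)"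
      unfolding eq by (rule add_mult_distrib_mat[OF cg hA c1])
    also have "h * A i * A (Suc i) = h * (A i * A (Suc i))" by (rule assoc_mult_mat[OF h(1) c0 c1])
    also have "\<dots> = 0\<^sub>m ?n (length (ds (Suc (Suc i))))" unfolding AA using h(1) by simp
    also have "A (Suc i) * g * A (Suc i) + 0\<^sub>m ?n (length (ds (Suc (Suc i)))) = A (Suc i) * g * A (Suc i)"
      using cg c1 by (intro right_add_zero_mat) simp
    finally have "\<phi> (Suc i) * A (Suc i) = A (Suc i) * g * A (Suc i)" .
    moreover have "no_constant_terms (\<phi> (Suc i))"
      unfolding eq using no_constant_terms_mult[OF c1 g(1)] no_constant_terms_mult[OF h(1) c0] nA
      by (intro no_constant_terms_add[OF cg hA]) auto
    ultimately show ?case using g(1) by blast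
  qed
  then show ?thesis by blast
qed

lemma count_list_card: "count_list xs x = card {i. i < length xs \<and> xs ! i = x}"
proof -
  have "count_list xs x = length (filter (\<lambda>y. y = x) xs)"
    by (induction xs) auto
  then show ?thesis by (simp add: length_filter_conv_card)
qed

text \<open>Going to the other resolution and back differs from the identity by a null-homotopic
  map, hence is the identity modulo the variables. A nonzero constant entry can only link generators
  of equal degree, so the block of constants in degree \<open>j\<close> already has a left
  inverse.\<close>

lemma minimal_resolution_count_le:
  fixes I :: "('v, 'k::field) mpoly set"
  assumes I: "homogeneous_ideal I"
    and M: "minimal_graded_free_resolution I ds A e" and R': "graded_free_resolution I ds' A' e'"
  shows "count_list (ds i) j \<le> count_list (ds' i) j"
proof -
  have R: "graded_free_resolution I ds A e" using M by (simp add: minimal_graded_free_resolution_def)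
  obtain f where f: "\<And>i. graded_hom (ds i) (ds' i) (f i)" "\<And>i. f i * A i = A' i * f (Suc i)"
    "\<And>v. v\<in>carrier_vec (length (ds 0)) \<Longrightarrow> e \<bullet> v - e' \<bullet> (f 0 *\<^sub>v v) \<in> I"
    using resolution_lift[OF I R R'] by blast
  obtain g where g: "\<And>i. graded_hom (ds' i) (ds i) (g i)" "\<And>i. g i * A' i = A i * g (Suc i)"
    "\<And>v. v\<in>carrier_vec (length (ds' 0)) \<Longrightarrow> e' \<bullet> v - e \<bullet> (g 0 *\<^sub>v v) \<in> I"
    using resolution_lift[OF I R' R] by blast
  have cf: "f i \<in> carrier_mat (length (ds' i)) (length (ds i))" and cg: "g i \<in> carrier_mat (length (ds i)) (length (ds' i))" for i
    using f(1) g(1) by (auto simp: graded_hom_def)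
  note cA = resolutionD(2)[OF R] and cA' = resolutionD(2)[OF R'] and ce = resolutionD(3)[OF R]
  define \<phi> where "\<phi> i = g i * f i - 1\<^sub>m (length (ds i))" for i
  have gf: "g i * f i \<in> carrier_mat (length (ds i)) (length (ds i))" for i using cf cg by (rule mult_carrier_mat[rotated])
  have c\<phi>: "\<phi> i \<in> carrier_mat (length (ds i)) (length (ds i))" for i
    unfolding \<phi>_def by (rule minus_carrier_mat) simp
  have "no_constant_terms (\<phi> i)"
  proof (rule minimal_null_homotopic[OF M c\<phi>])
    fix i
    have "g i * f i * A i = g i * (f i * A i)" by (rule assoc_mult_mat[OF cg cf cA])
    also have "\<dots> = g i * (A' i * f (Suc i))" by (simp add: f(2))
    also have "\<dots> = g i * A' i * f (Suc i)" by (rule assoc_mult_mat[OF cg cA' cf, symmetric])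
    also have "\<dots> = A i * (g (Suc i) * f (Suc i))" unfolding g(2) by (rule assoc_mult_mat[OF cA cg cf])
    finally have "g i * f i * A i = A i * (g (Suc i) * f (Suc i))" .
    then show "\<phi> i * A i = A i * \<phi> (Suc i)"
      unfolding \<phi>_def minus_mult_distrib_mat[OF gf one_carrier_mat cA] mult_minus_distrib_mat[OF cA gf one_carrier_mat]
      using cA[of i] by simp
  next
    fix v :: "('v, 'k) mpoly vec" assume v: "v \<in> carrier_vec (length (ds 0))"
    have fv: "f 0 *\<^sub>v v \<in> carrier_vec (length (ds' 0))" by (rule mult_mat_vec_carrier[OF cf v])
    have "- ((e \<bullet> v - e' \<bullet> (f 0 *\<^sub>v v)) + (e' \<bullet> (f 0 *\<^sub>v v) - e \<bullet> (g 0 *\<^sub>v (f 0 *\<^sub>v v)))) \<in> I"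
      by (intro homogeneous_idealD(2,5)[OF I] f g v fv)
    moreover have "\<phi> 0 *\<^sub>v v = g 0 *\<^sub>v (f 0 *\<^sub>v v) - v"
      unfolding \<phi>_def minus_mult_distrib_mat_vec[OF gf one_carrier_mat v] using assoc_mult_mat_vec[OF cg cf v] v by simp
    moreover have "e \<bullet> (g 0 *\<^sub>v (f 0 *\<^sub>v v) - v) = e \<bullet> (g 0 *\<^sub>v (f 0 *\<^sub>v v)) - e \<bullet> v"
      by (rule scalar_prod_minus_distrib[OF ce mult_mat_vec_carrier[OF cg fv] v])
    ultimately show "e \<bullet> (\<phi> 0 *\<^sub>v v) \<in> I" by simp
  qed
  then have const: "Poly_Mapping.lookup ((g i * f i) $$ (c, b)) 0 = (if c = b then 1 else 0)"
    if "c < length (ds i)" "b < length (ds i)" for c b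
    using that gf[of i] c\<phi>[of i] unfolding no_constant_terms_def \<phi>_def
    by (force simp: lookup_minus lookup_one)
  define S where "S = {b. b < length (ds i) \<and> ds i ! b = j}"
  define T where "T = {a. a < length (ds' i) \<and> ds' i ! a = j}"
  have "card S \<le> card T"
  proof (rule card_le_of_left_inverse)
    show "finite S" "finite T" by (auto simp: S_def T_def)
    fix b c assume bc: "b \<in> S" "c \<in> S"
    have l: "c < length (ds i)" "b < length (ds i)" using bc by (auto simp: S_def)
    have "(\<Sum>a\<in>T. Poly_Mapping.lookup (g i $$ (c, a)) 0 * Poly_Mapping.lookup (f i $$ (a, b)) 0) =
      (\<Sum>a<length (ds' i). Poly_Mapping.lookup (g i $$ (c, a)) 0 * Poly_Mapping.lookup (f i $$ (a, b)) 0)"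
    proof (rule sum.mono_neutral_left)
      show "T \<subseteq> {..<length (ds' i)}" by (auto simp: T_def)
      show "\<forall>a\<in>{..<length (ds' i)} - T. Poly_Mapping.lookup (g i $$ (c, a)) 0 * Poly_Mapping.lookup (f i $$ (a, b)) 0 = 0"
      proof
        fix a assume a: "a \<in> {..<length (ds' i)} - T"
        then have "homogeneous (f i $$ (a, b)) (ds i ! b - ds' i ! a)" using f(1)[of i] l by (auto simp: graded_hom_def)
        moreover have "ds i ! b - ds' i ! a \<noteq> 0" using a bc by (auto simp: S_def T_def)
        ultimately show "Poly_Mapping.lookup (g i $$ (c, a)) 0 * Poly_Mapping.lookup (f i $$ (a, b)) 0 = 0"
          by (simp add: constant_term_homogeneous)
      qed
    qed simp
    also have "\<dots> = Poly_Mapping.lookup ((g i * f i) $$ (c, b)) 0"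
      unfolding mult_mat_entry[OF cg cf l] constant_term_sum constant_term_mult ..
    also have "\<dots> = (if c = b then 1 else 0)" by (rule const[OF l])
    finally show "(\<Sum>a\<in>T. Poly_Mapping.lookup (g i $$ (c, a)) 0 * Poly_Mapping.lookup (f i $$ (a, b)) 0) = (if c = b then 1 else 0)" .
  qed
  then show ?thesis by (simp add: count_list_card S_def T_def)
qed

text \<open>The degrees behind \<open>graded_betti\<close> belong to an unspecified minimal
  resolution; comparing it with the given one in both directions determines each count.\<close>

lemma graded_betti_eq_count:
  assumes I: "homogeneous_ideal I" and M: "minimal_graded_free_resolution I ds A e"
  shows "graded_betti I i j = count_list (ds i) j"
proof -
  have "\<exists>A e. minimal_graded_free_resolution I (resolution_degrees I) A e"
    unfolding resolution_degrees_def by (rule someI[where P = "\<lambda>ds. \<exists>A e. minimal_graded_free_resolution I ds A e"]) (use M in blast)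
  then obtain A' e' where M': "minimal_graded_free_resolution I (resolution_degrees I) A' e'" by blast
  show ?thesis unfolding graded_betti_def
    using minimal_resolution_count_le[OF I M, of "resolution_degrees I" A' e' i j]
      minimal_resolution_count_le[OF I M', of ds A e i j] M M'
    unfolding minimal_graded_free_resolution_def by (simp add: le_antisym)
qed

section \<open>From frames to resolutions\<close>

definition squarefree_exponent :: "'v set \<Rightarrow> 'v \<Rightarrow>\<^sub>0 nat" where
  "squarefree_exponent w = (\<Sum>v\<in>w. Poly_Mapping.single v 1)"

lemma lookup_squarefree_exponent:
  "finite w \<Longrightarrow> Poly_Mapping.lookup (squarefree_exponent w) v = (if v \<in> w then 1 else 0)"
  by (simp add: squarefree_exponent_def lookup_sum lookup_single when_def sum.delta)

lemma keys_squarefree_exponent: "finite w \<Longrightarrow> Poly_Mapping.keys (squarefree_exponent w) = w"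
  by (auto simp: in_keys_iff lookup_squarefree_exponent split: if_splits)

lemma monomial_degree_squarefree_exponent: "finite w \<Longrightarrow> monomial_degree (squarefree_exponent w) = card w"
  by (simp add: monomial_degree_def keys_squarefree_exponent lookup_squarefree_exponent)

lemma lookup_single_mult:
  fixes p :: "('v, 'k::field) mpoly"
  shows "Poly_Mapping.lookup (Poly_Mapping.single m c * p) n =
    (if \<forall>v. Poly_Mapping.lookup m v \<le> Poly_Mapping.lookup n v then c * Poly_Mapping.lookup p (n - m) else 0)"
proof -
  define le where "le \<longleftrightarrow> (\<forall>v. Poly_Mapping.lookup m v \<le> Poly_Mapping.lookup n v)"
  have *: "n = m + q \<longleftrightarrow> le \<and> q = n - m" for q
    unfolding le_def by (auto simp: poly_mapping_eq_iff fun_eq_iff lookup_add lookup_minus)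
  have "Poly_Mapping.lookup (Poly_Mapping.single m c * p) n = c * (\<Sum>q. Poly_Mapping.lookup p q when n = m + q)"
    by (simp add: lookup_mult lookup_single when_mult)
  also have "\<dots> = (if le then c * Poly_Mapping.lookup p (n - m) else 0)"
    unfolding * by (cases le) simp_all
  finally show ?thesis unfolding le_def .
qed

lemma sum_monomials: "(\<Sum>m\<in>Poly_Mapping.keys f. Poly_Mapping.single m (Poly_Mapping.lookup f m)) = f"
proof (rule poly_mapping_eqI)
  show "Poly_Mapping.lookup (\<Sum>m\<in>Poly_Mapping.keys f. Poly_Mapping.single m (Poly_Mapping.lookup f m)) k = Poly_Mapping.lookup f k" for k
    by (auto simp: lookup_sum lookup_single when_def sum.delta' in_keys_iff)
qed

text \<open>For upward closed \<open>P\<close> this is a squarefree monomial ideal: membership of a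
  monomial depends on its support alone, so \<open>P\<close> is the same predicate as in
  \<open>frame\<close>.\<close>

definition monomial_ideal :: "('v set \<Rightarrow> bool) \<Rightarrow> ('v, 'k::field) mpoly set" where
  "monomial_ideal P = {f. \<forall>m\<in>Poly_Mapping.keys f. P (Poly_Mapping.keys m)}"

lemma homogeneous_monomial_ideal:
  assumes P: "\<And>U V. P U \<Longrightarrow> U \<subseteq> V \<Longrightarrow> P V"
  shows "homogeneous_ideal (monomial_ideal P :: ('v, 'k::field) mpoly set)"
  unfolding homogeneous_ideal_def
proof (intro conjI ballI allI)
  fix f g :: "('v, 'k) mpoly" and d
  assume f: "f \<in> monomial_ideal P"
  show "f + g \<in> monomial_ideal P" if "g \<in> monomial_ideal P"
    using f that keys_add[of f g] unfolding monomial_ideal_def by blast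
  show "f * g \<in> monomial_ideal P"
    unfolding monomial_ideal_def
  proof safe
    fix m assume "m \<in> Poly_Mapping.keys (f * g)"
    then obtain a b where ab: "m = a + b" "a \<in> Poly_Mapping.keys f" using keys_mult[of f g] by blast
    then have "Poly_Mapping.keys a \<subseteq> Poly_Mapping.keys m" by (auto simp: in_keys_iff lookup_add)
    then show "P (Poly_Mapping.keys m)" using f ab(2) P unfolding monomial_ideal_def by blast
  qed
  show "homogeneous_part d f \<in> monomial_ideal P"
    using f unfolding monomial_ideal_def by (auto simp: in_keys_iff homogeneous_part.rep_eq split: if_splits)
qed (simp add: monomial_ideal_def)

text \<open>A term whose support contains an edge is divisible by the generator of that edge, and a
  polynomial is the sum of its terms.\<close>

lemma edge_ideal_eq_monomial_ideal:
  "(edge_ideal E :: ('v, 'k::field) mpoly set) = monomial_ideal (\<lambda>U. \<exists>u v. u \<noteq> v \<and> {u, v} \<in> E \<and> u \<in> U \<and> v \<in> U)"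
    (is "_ = monomial_ideal ?P")
proof -
  interpret M: module "(*) :: ('v, 'k) mpoly \<Rightarrow> ('v, 'k) mpoly \<Rightarrow> ('v, 'k) mpoly"
    by unfold_locales (simp_all add: algebra_simps)
  let ?G = "{var u * var v | u v. u \<noteq> v \<and> {u, v} \<in> E} :: ('v, 'k) mpoly set"
  have var_mult: "var u * var v = (Poly_Mapping.single (Poly_Mapping.single u 1 + Poly_Mapping.single v 1) 1 :: ('v, 'k) mpoly)" for u v
    by (simp add: var_def mult_single)
  have hom: "homogeneous_ideal (monomial_ideal ?P :: ('v, 'k) mpoly set)"
    by (rule homogeneous_monomial_ideal) blast
  have "M.span ?G \<subseteq> monomial_ideal ?P"
  proof (rule M.span_minimal)
    show "M.subspace (monomial_ideal ?P)"
      unfolding M.subspace_def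
    proof (intro conjI ballI allI)
      fix c x :: "('v, 'k) mpoly" assume "x \<in> monomial_ideal ?P"
      then show "c * x \<in> monomial_ideal ?P" by (subst mult.commute) (rule homogeneous_idealD(3)[OF hom])
    qed (use homogeneous_idealD(1,2)[OF hom] in auto)
    show "?G \<subseteq> monomial_ideal ?P"
    proof
      fix f assume "f \<in> ?G"
      then obtain u v where uv: "f = var u * var v" "u \<noteq> v" "{u, v} \<in> E" by blast
      have "u \<in> Poly_Mapping.keys (Poly_Mapping.single u 1 + Poly_Mapping.single v (1::nat))"
        "v \<in> Poly_Mapping.keys (Poly_Mapping.single u 1 + Poly_Mapping.single v (1::nat))"
        by (simp_all add: in_keys_iff lookup_add)
      then show "f \<in> monomial_ideal ?P" using uv unfolding monomial_ideal_def var_mult by auto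
    qed
  qed
  moreover have "f \<in> M.span ?G" if f: "f \<in> monomial_ideal ?P" for f
  proof -
    have "Poly_Mapping.single m (Poly_Mapping.lookup f m) \<in> M.span ?G" if m: "m \<in> Poly_Mapping.keys f" for m
    proof -
      obtain u v where uv: "u \<noteq> v" "{u, v} \<in> E" "u \<in> Poly_Mapping.keys m" "v \<in> Poly_Mapping.keys m"
        using f m unfolding monomial_ideal_def by blast
      let ?s = "Poly_Mapping.single u 1 + Poly_Mapping.single v (1::nat)"
      have "(m - ?s) + ?s = m"
        using uv by (auto simp: poly_mapping_eq_iff fun_eq_iff lookup_add lookup_minus lookup_single in_keys_iff when_def)
      then have "Poly_Mapping.single m (Poly_Mapping.lookup f m) = Poly_Mapping.single (m - ?s) (Poly_Mapping.lookup f m) * (var u * var v)"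
        unfolding var_mult by (simp add: mult_single)
      also have "\<dots> \<in> M.span ?G" using uv by (intro M.span_scale M.span_base) blast
      finally show ?thesis .
    qed
    then have "(\<Sum>m\<in>Poly_Mapping.keys f. Poly_Mapping.single m (Poly_Mapping.lookup f m)) \<in> M.span ?G"
      by (rule M.span_sum)
    then show ?thesis by (simp add: sum_monomials)
  qed
  ultimately show ?thesis unfolding edge_ideal_def by blast
qed

text \<open>Matrices need an ordered basis in each homological degree; any enumeration
  \<open>L\<close> will do.\<close>

locale listed_frame =
  fixes P :: "'v set \<Rightarrow> bool" and B h and c :: "'v set \<Rightarrow> 'v set \<Rightarrow> 'k::field" and L :: "nat \<Rightarrow> 'v set list"
  assumes frame: "frame P B h c"
    and set_L: "set (L i) = {w \<in> B. h w = i}"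
    and distinct_L: "distinct (L i)"
begin

lemmas fD = frameD[OF frame]

definition poly_diff :: "('v set \<Rightarrow> ('v, 'k) mpoly) \<Rightarrow> 'v set \<Rightarrow> ('v, 'k) mpoly" where
  "poly_diff p v = (\<Sum>w\<in>B. Poly_Mapping.single (squarefree_exponent (w - v)) (c v w) * p w)"

text \<open>The part of multidegree \<open>\<alpha>\<close>; the truncated subtraction is harmless since \<open>w\<close> lies in the support of \<open>\<alpha>\<close>.\<close>

definition strand :: "('v set \<Rightarrow> ('v, 'k) mpoly) \<Rightarrow> ('v \<Rightarrow>\<^sub>0 nat) \<Rightarrow> 'v set \<Rightarrow> 'k" where
  "strand p \<alpha> w = (if w \<in> B \<and> w \<subseteq> Poly_Mapping.keys \<alpha> then Poly_Mapping.lookup (p w) (\<alpha> - squarefree_exponent w) else 0)"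

lemma strand_in_frame_chains: "strand p \<alpha> \<in> frame_chains B (Poly_Mapping.keys \<alpha>)"
  by (auto simp: frame_chains_def strand_def)

lemma subset_keys_add: "w \<in> B \<Longrightarrow> w \<subseteq> Poly_Mapping.keys (\<gamma> + squarefree_exponent w)"
  using fD(3) by (auto simp: in_keys_iff lookup_add lookup_squarefree_exponent)

lemma lookup_eq_strand: "w \<in> B \<Longrightarrow> Poly_Mapping.lookup (p w) \<gamma> = strand p (\<gamma> + squarefree_exponent w) w"
  using subset_keys_add by (simp add: strand_def)

lemma eq_of_strands:
  assumes "w \<in> B" "\<And>\<alpha>. strand p \<alpha> w = strand q \<alpha> w"
  shows "p w = q w"
  by (rule poly_mapping_eqI) (simp add: lookup_eq_strand assms)

lemma diff_add_squarefree:
  assumes "w \<in> B" "w \<subseteq> Poly_Mapping.keys \<alpha>"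
  shows "(\<alpha> - squarefree_exponent w) + squarefree_exponent w = \<alpha>"
  using assms fD(3)[of w]
  by (auto simp: poly_mapping_eq_iff fun_eq_iff lookup_add lookup_minus lookup_squarefree_exponent in_keys_iff subset_iff)

text \<open>Multiplication by the monomial of \<open>w - v\<close> moves the coefficient at
  \<open>\<alpha>\<close> minus \<open>w\<close> to the one at \<open>\<alpha>\<close> minus
  \<open>v\<close>. Hence in each multidegree the polynomial differential is the scalar one, which
  depends only on the support of \<open>\<alpha>\<close>.\<close>

lemma strand_poly_diff: "strand (poly_diff p) \<alpha> v = frame_diff B c (strand p \<alpha>) v"
proof (cases "v \<in> B \<and> v \<subseteq> Poly_Mapping.keys \<alpha>")
  case False
  have "c v w * strand p \<alpha> w = 0" for w
    using False fD(8,10)[of v w] by (auto simp: strand_def)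
  then have "frame_diff B c (strand p \<alpha>) v = 0" by (simp add: frame_diff_def)
  moreover have "strand (poly_diff p) \<alpha> v = 0" using False by (auto simp: strand_def)
  ultimately show ?thesis by simp
next
  case True
  have "Poly_Mapping.lookup (Poly_Mapping.single (squarefree_exponent (w - v)) (c v w) * p w) (\<alpha> - squarefree_exponent v)
    = c v w * strand p \<alpha> w" if w: "w \<in> B" for w
  proof (cases "c v w = 0")
    case False
    then have vw: "v \<subset> w" by (rule fD(10))
    have fin: "finite v" "finite w" "finite (w - v)" using True w fD(3) by auto
    have le: "(\<forall>x. Poly_Mapping.lookup (squarefree_exponent (w - v)) x \<le> Poly_Mapping.lookup (\<alpha> - squarefree_exponent v) x)
      \<longleftrightarrow> w \<subseteq> Poly_Mapping.keys \<alpha>"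
      using True fin by (auto simp: lookup_squarefree_exponent lookup_minus in_keys_iff subset_iff Suc_le_eq)
    have "\<alpha> - squarefree_exponent v - squarefree_exponent (w - v) = \<alpha> - squarefree_exponent w"
      using vw fin by (auto simp: poly_mapping_eq_iff fun_eq_iff lookup_minus lookup_squarefree_exponent)
    then show ?thesis unfolding lookup_single_mult le using w by (simp add: strand_def)
  qed simp
  then show ?thesis using True by (simp add: strand_def[of "poly_diff p"] poly_diff_def lookup_sum frame_diff_def)
qed

lemma poly_diff_outside: "v \<notin> B \<Longrightarrow> poly_diff p v = 0"
  unfolding poly_diff_def using fD(8)[of v] by (intro sum.neutral) (metis mult_zero_left single_zero)

lemma poly_diff_poly_diff: "poly_diff (poly_diff p) v = 0"
proof (cases "v \<in> B")
  case True
  have "strand (poly_diff (poly_diff p)) \<alpha> v = strand (\<lambda>_. 0) \<alpha> v" for \<alpha>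
  proof -
    have "strand (poly_diff (poly_diff p)) \<alpha> v = (\<Sum>w\<in>B. c v w * (\<Sum>u\<in>B. c w u * strand p \<alpha> u))"
      unfolding strand_poly_diff unfolding frame_diff_def by (simp add: strand_poly_diff frame_diff_def)
    also have "\<dots> = (\<Sum>u\<in>B. (\<Sum>w\<in>B. c v w * c w u) * strand p \<alpha> u)"
      unfolding sum_distrib_left sum_distrib_right by (subst sum.swap) (simp add: mult.assoc)
    also have "\<dots> = 0" by (simp add: fD(12))
    finally show ?thesis by (simp add: strand_def)
  qed
  then show ?thesis by (rule eq_of_strands[OF True, of _ "\<lambda>_. 0"])
qed (rule poly_diff_outside)

text \<open>The equation is solved in each multidegree separately and the scalar solutions are
  assembled into polynomials; the point to secure is finite support.\<close>

lemma poly_diff_exact: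
  assumes supp: "\<And>w. p w \<noteq> 0 \<Longrightarrow> w \<in> B \<and> h w = i"
    and cycle: "\<And>v. poly_diff p v = 0"
    and I: "i = 0 \<Longrightarrow> p {} \<in> monomial_ideal P"
  shows "\<exists>q. (\<forall>w. q w \<noteq> 0 \<longrightarrow> w \<in> B \<and> h w = Suc i) \<and> (\<forall>v. poly_diff q v = p v)"
proof -
  \<comment> \<open>Outside the ideal a frame gives no exactness, so the strand itself must vanish
    there. At \<open>{}\<close> this is the assumption on \<open>p {}\<close>.\<close>
  have nP: "strand p \<alpha> w = 0" if "\<not> P (Poly_Mapping.keys \<alpha>)" for \<alpha> w
  proof (cases "w = {}")
    case True
    have "Poly_Mapping.lookup (p {}) \<alpha> = 0"
    proof (cases "p {} = 0")
      case False
      then have "i = 0" using supp[of "{}"] fD(5) by simp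
      then show ?thesis using I that unfolding monomial_ideal_def by (auto simp: in_keys_iff)
    qed simp
    then show ?thesis by (simp add: strand_def True squarefree_exponent_def)
  next
    case False
    then show ?thesis using frame_chains_trivial[OF frame that strand_in_frame_chains] by blast
  qed
  \<comment> \<open>The last conjunct selects the solution 0 for a zero strand; otherwise the
    choices could be nonzero in infinitely many multidegrees.\<close>
  have "\<exists>y. y \<in> frame_chains B (Poly_Mapping.keys \<alpha>) \<and> (\<forall>w. y w \<noteq> 0 \<longrightarrow> h w = Suc i) \<and>
      (\<forall>v. frame_diff B c y v = strand p \<alpha> v) \<and> ((\<forall>w. strand p \<alpha> w = 0) \<longrightarrow> y = (\<lambda>_. 0))" for \<alpha>
  proof (cases "\<forall>w. strand p \<alpha> w = 0")
    case True
    then show ?thesis by (intro exI[of _ "\<lambda>_. 0"]) (simp add: frame_chains_def frame_diff_def)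
  next
    case False
    then have "P (Poly_Mapping.keys \<alpha>)" using nP by blast
    moreover have "frame_diff B c (strand p \<alpha>) v = 0" for v
      unfolding strand_poly_diff[symmetric] by (simp add: strand_def cycle)
    moreover have "h w = i" if "strand p \<alpha> w \<noteq> 0" for w
      using that supp[of w] by (cases "p w = 0") (auto simp: strand_def split: if_splits)
    ultimately show ?thesis
      using frame_exact_homogeneous[OF frame _ strand_in_frame_chains, of \<alpha> p i] False by blast
  qed
  from choice[OF allI[OF this]] obtain Y where "\<forall>\<alpha>. Y \<alpha> \<in> frame_chains B (Poly_Mapping.keys \<alpha>) \<and>
      (\<forall>w. Y \<alpha> w \<noteq> 0 \<longrightarrow> h w = Suc i) \<and> (\<forall>v. frame_diff B c (Y \<alpha>) v = strand p \<alpha> v) \<and>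
      ((\<forall>w. strand p \<alpha> w = 0) \<longrightarrow> Y \<alpha> = (\<lambda>_. 0))" ..
  then have Y: "\<And>\<alpha>. Y \<alpha> \<in> frame_chains B (Poly_Mapping.keys \<alpha>)" "\<And>\<alpha> w. Y \<alpha> w \<noteq> 0 \<Longrightarrow> h w = Suc i"
      "\<And>\<alpha> v. frame_diff B c (Y \<alpha>) v = strand p \<alpha> v" "\<And>\<alpha> w. (\<forall>w. strand p \<alpha> w = 0) \<Longrightarrow> Y \<alpha> w = 0"
    by simp_all
  \<comment> \<open>A finite set containing every multidegree in which \<open>p\<close> has a
    nonzero strand.\<close>
  define K where "K = (\<Union>w\<in>B. (\<lambda>\<gamma>. \<gamma> + squarefree_exponent w) ` Poly_Mapping.keys (p w))"
  have "finite K" unfolding K_def using fD(2) by auto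
  have YK: "\<alpha> \<in> K" if nz: "Y \<alpha> w \<noteq> 0" for \<alpha> w
  proof -
    obtain w' where w': "strand p \<alpha> w' \<noteq> 0" using Y(4)[of \<alpha> w] nz by auto
    then have k: "w' \<in> B" "w' \<subseteq> Poly_Mapping.keys \<alpha>" "\<alpha> - squarefree_exponent w' \<in> Poly_Mapping.keys (p w')"
      by (auto simp: strand_def in_keys_iff split: if_splits)
    show ?thesis unfolding K_def
      by (rule UN_I[OF k(1)], rule image_eqI[OF _ k(3)]) (rule diff_add_squarefree[OF k(1,2), symmetric])
  qed
  define q where "q w = Abs_poly_mapping (\<lambda>\<gamma>. Y (\<gamma> + squarefree_exponent w) w)" for w
  have "finite {\<gamma>. Y (\<gamma> + squarefree_exponent w) w \<noteq> 0}" for w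
  proof (rule finite_subset)
    show "{\<gamma>. Y (\<gamma> + squarefree_exponent w) w \<noteq> 0} \<subseteq> (\<lambda>\<gamma>. \<gamma> + squarefree_exponent w) -` K"
      using YK by blast
    show "finite ((\<lambda>\<gamma>. \<gamma> + squarefree_exponent w) -` K)"
      by (rule finite_vimageI[OF \<open>finite K\<close>]) (simp add: inj_on_def)
  qed
  then have lq: "Poly_Mapping.lookup (q w) \<gamma> = Y (\<gamma> + squarefree_exponent w) w" for w \<gamma>
    unfolding q_def by simp
  have sq: "strand q \<alpha> w = Y \<alpha> w" for \<alpha> w
    using Y(1)[of \<alpha>] diff_add_squarefree[of w \<alpha>] by (auto simp: strand_def lq frame_chains_def)
  have "w \<in> B \<and> h w = Suc i" if nz: "q w \<noteq> 0" for w
  proof -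
    obtain \<gamma> where "Poly_Mapping.lookup (q w) \<gamma> \<noteq> 0" using nz by (metis lookup_zero poly_mapping_eqI)
    then show ?thesis using Y(1)[of "\<gamma> + squarefree_exponent w"] Y(2) unfolding lq frame_chains_def by blast
  qed
  moreover have "poly_diff q v = p v" for v
  proof (cases "v \<in> B")
    case True
    have "frame_diff B c (strand q \<alpha>) v = strand p \<alpha> v" for \<alpha>
      using Y(3)[of \<alpha> v] by (simp add: frame_diff_def sq)
    then show ?thesis by (intro eq_of_strands[OF True]) (simp add: strand_poly_diff)
  next
    case False
    then show ?thesis using supp[of v] poly_diff_outside by metis
  qed
  ultimately show ?thesis by blast
qed

section \<open>Translation of the differential into matrices\<close>

definition vec_of :: "nat \<Rightarrow> ('v set \<Rightarrow> ('v, 'k) mpoly) \<Rightarrow> ('v, 'k) mpoly vec" where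
  "vec_of i p = vec (length (L i)) (\<lambda>a. p (L i ! a))"

definition res_matrix :: "nat \<Rightarrow> ('v, 'k) mpoly mat" where
  "res_matrix i = mat (length (L i)) (length (L (Suc i)))
     (\<lambda>(a, b). Poly_Mapping.single (squarefree_exponent (L (Suc i) ! b - L i ! a)) (c (L i ! a) (L (Suc i) ! b)))"

definition res_degrees :: "nat \<Rightarrow> int list" where
  "res_degrees i = map (\<lambda>w. int (card w)) (L i)"

text \<open>As \<open>L 0\<close> is \<open>[{}]\<close>, the module F_0 is R itself and this is the
  residue map to R/I.\<close>

definition res_augmentation :: "('v, 'k) mpoly vec" where
  "res_augmentation = vec (length (L 0)) (\<lambda>_. 1)"

lemma L_nth: "a < length (L i) \<Longrightarrow> L i ! a \<in> B \<and> h (L i ! a) = i"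
  using set_L[of i] nth_mem by blast

lemma L_zero: "L 0 = [{}]"
proof -
  have "w = {}" if "w \<in> set (L 0)" for w
    using that set_L[of 0] fD(7)[of w] by auto
  moreover have "{} \<in> set (L 0)" using set_L[of 0] fD(4,5) by auto
  ultimately have "set (L 0) = {{}}" by blast
  then have "length (L 0) = 1" using distinct_card[OF distinct_L[of 0]] by simp
  then obtain w where "L 0 = [w]" by (auto simp: length_Suc_conv)
  then show ?thesis using \<open>set (L 0) = {{}}\<close> by simp
qed

lemma sum_L: "(\<Sum>b<length (L i). f (L i ! b)) = (\<Sum>w\<in>{w \<in> B. h w = i}. f w)"
  unfolding set_L[symmetric] using bij_betw_nth[OF distinct_L[of i] refl refl]
  by (rule sum.reindex_bij_betw)

lemma vec_of_surj:
  assumes "v \<in> carrier_vec (length (L i))"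
  obtains p where "v = vec_of i p" "\<And>w. p w \<noteq> 0 \<Longrightarrow> w \<in> B \<and> h w = i"
proof -
  \<comment> \<open>The list is distinct, so the sum has one term for \<open>w\<close> in
    \<open>L i\<close>, and it takes the default 0 elsewhere.\<close>
  define p where "p w = (\<Sum>a | a < length (L i) \<and> L i ! a = w. v $ a)" for w
  have "p (L i ! a) = v $ a" if "a < length (L i)" for a
  proof -
    have "{a'. a' < length (L i) \<and> L i ! a' = L i ! a} = {a}"
      using that nth_eq_iff_index_eq[OF distinct_L[of i]] by auto
    then show ?thesis by (simp add: p_def)
  qed
  then have "v = vec_of i p" using assms by (intro eq_vecI) (auto simp: vec_of_def)
  moreover have "w \<in> B \<and> h w = i" if "p w \<noteq> 0" for w
  proof -
    have "{a. a < length (L i) \<and> L i ! a = w} \<noteq> {}" using that unfolding p_def by (metis sum.empty)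
    then show ?thesis using L_nth by blast
  qed
  ultimately show thesis using that by blast
qed

lemma res_matrix_vec_of: "res_matrix i *\<^sub>v vec_of (Suc i) p = vec_of i (poly_diff p)"
proof (rule eq_vecI)
  fix a assume "a < dim_vec (vec_of i (poly_diff p))"
  then have a: "a < length (L i)" by (simp add: vec_of_def)
  have "(res_matrix i *\<^sub>v vec_of (Suc i) p) $ a =
    (\<Sum>b<length (L (Suc i)). Poly_Mapping.single (squarefree_exponent (L (Suc i) ! b - L i ! a)) (c (L i ! a) (L (Suc i) ! b)) * p (L (Suc i) ! b))"
    using a by (subst mult_mat_vec_entry[of _ "length (L i)" "length (L (Suc i))"]) (auto simp: res_matrix_def vec_of_def)
  also have "\<dots> = (\<Sum>w\<in>{w \<in> B. h w = Suc i}. Poly_Mapping.single (squarefree_exponent (w - L i ! a)) (c (L i ! a) w) * p w)"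
    by (rule sum_L)
  also have "\<dots> = poly_diff p (L i ! a)"
    unfolding poly_diff_def
  proof (rule sum.mono_neutral_left)
    show "\<forall>w\<in>B - {w \<in> B. h w = Suc i}. Poly_Mapping.single (squarefree_exponent (w - L i ! a)) (c (L i ! a) w) * p w = 0"
      using fD(11)[of "L i ! a"] L_nth[OF a] by (metis (mono_tags, lifting) DiffD1 DiffD2 mem_Collect_eq mult_zero_left single_zero)
  qed (use fD(2) in auto)
  finally show "(res_matrix i *\<^sub>v vec_of (Suc i) p) $ a = vec_of i (poly_diff p) $ a"
    using a by (simp add: vec_of_def)
qed (simp add: res_matrix_def vec_of_def)

lemma vec_of_eq_iff:
  "vec_of i p = vec_of i q \<longleftrightarrow> (\<forall>w\<in>B. h w = i \<longrightarrow> p w = q w)"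
proof
  assume eq: "vec_of i p = vec_of i q"
  show "\<forall>w\<in>B. h w = i \<longrightarrow> p w = q w"
  proof (intro ballI impI)
    fix w assume "w \<in> B" "h w = i"
    then have "w \<in> set (L i)" using set_L by blast
    then obtain a where a: "a < length (L i)" "L i ! a = w" by (auto simp: in_set_conv_nth)
    then show "p w = q w" using arg_cong[OF eq, of "\<lambda>v. v $ a"] by (simp add: vec_of_def)
  qed
next
  assume "\<forall>w\<in>B. h w = i \<longrightarrow> p w = q w"
  then show "vec_of i p = vec_of i q" using L_nth by (auto simp: vec_of_def)
qed

lemma poly_diff_supp:
  assumes supp: "\<And>w. p w \<noteq> 0 \<Longrightarrow> w \<in> B \<and> h w = Suc i" and "h v \<noteq> i"
  shows "poly_diff p v = 0"
  unfolding poly_diff_def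
proof (rule sum.neutral, rule ballI)
  fix w
  have "c v w = 0 \<or> p w = 0" using supp[of w] fD(11)[of v w] assms(2) by (cases "c v w = 0"; cases "p w = 0") auto
  then show "Poly_Mapping.single (squarefree_exponent (w - v)) (c v w) * p w = 0" by auto
qed

lemma augmentation_vec_of: "res_augmentation \<bullet> vec_of 0 p = p {}"
  by (simp add: res_augmentation_def vec_of_def scalar_prod_def L_zero)

lemma poly_diff_in_ideal: "poly_diff p {} \<in> monomial_ideal P"
proof -
  have hom: "homogeneous_ideal (monomial_ideal P :: ('v, 'k) mpoly set)"
    using fD(1) by (rule homogeneous_monomial_ideal)
  have "Poly_Mapping.single (squarefree_exponent (w - {})) (c {} w) \<in> (monomial_ideal P :: ('v, 'k) mpoly set)" for w
  proof (cases "c {} w = 0")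
    case False
    then have "w \<in> B" "w \<noteq> {}" using fD(9,10)[of "{}" w] by auto
    then show ?thesis using fD(3,6)[of w] by (auto simp: monomial_ideal_def keys_squarefree_exponent)
  qed (simp add: monomial_ideal_def)
  then show ?thesis unfolding poly_diff_def
    by (intro homogeneous_ideal_sum[OF hom] homogeneous_idealD(3)[OF hom])
qed

lemma res_matrix_carrier: "res_matrix i \<in> carrier_mat (length (L i)) (length (L (Suc i)))"
  by (simp add: res_matrix_def)

lemma vec_of_carrier: "vec_of i p \<in> carrier_vec (length (L i))"
  by (simp add: vec_of_def)

lemma image_iff: "v \<in> mat_image (res_matrix i) \<longleftrightarrow>
  (\<exists>q. (\<forall>w. q w \<noteq> 0 \<longrightarrow> w \<in> B \<and> h w = Suc i) \<and> v = vec_of i (poly_diff q))"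
proof
  assume "v \<in> mat_image (res_matrix i)"
  then obtain u where "u \<in> carrier_vec (length (L (Suc i)))" "v = res_matrix i *\<^sub>v u"
    unfolding mat_image_def using res_matrix_carrier[of i] by auto
  then show "\<exists>q. (\<forall>w. q w \<noteq> 0 \<longrightarrow> w \<in> B \<and> h w = Suc i) \<and> v = vec_of i (poly_diff q)"
    using res_matrix_vec_of vec_of_surj by metis
next
  assume "\<exists>q. (\<forall>w. q w \<noteq> 0 \<longrightarrow> w \<in> B \<and> h w = Suc i) \<and> v = vec_of i (poly_diff q)"
  then show "v \<in> mat_image (res_matrix i)"
    using res_matrix_vec_of mult_in_image[OF res_matrix_carrier vec_of_carrier] by metis
qed

theorem minimal_resolution:
  "minimal_graded_free_resolution (monomial_ideal P) res_degrees res_matrix res_augmentation"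
  unfolding minimal_graded_free_resolution_def graded_free_resolution_def
proof (intro conjI allI impI)
  have len: "length (res_degrees i) = length (L i)" for i by (simp add: res_degrees_def)
  show "graded_hom (res_degrees (Suc i)) (res_degrees i) (res_matrix i)" for i
    unfolding graded_hom_def len
  proof (intro conjI allI impI)
    show "res_matrix i \<in> carrier_mat (length (L i)) (length (L (Suc i)))" by (rule res_matrix_carrier)
    fix a b assume ab: "a < length (L i)" "b < length (L (Suc i))"
    define v w where "v = L i ! a" and "w = L (Suc i) ! b"
    have fin: "finite v" "finite w" using L_nth[OF ab(1)] L_nth[OF ab(2)] fD(3) by (auto simp: v_def w_def)
    have "homogeneous (Poly_Mapping.single (squarefree_exponent (w - v)) (c v w)) (int (card w) - int (card v))"
    proof (cases "c v w = 0")
      case False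
      then have "v \<subset> w" by (rule fD(10))
      then have "int (card (w - v)) = int (card w) - int (card v)"
        using fin by (simp add: card_Diff_subset card_mono of_nat_diff psubset_imp_subset)
      then show ?thesis using fin by (simp add: homogeneous_def monomial_degree_squarefree_exponent)
    qed simp
    then show "homogeneous (res_matrix i $$ (a, b)) (res_degrees (Suc i) ! b - res_degrees i ! a)"
      using ab by (simp add: res_matrix_def res_degrees_def v_def w_def)
  qed
  show "res_augmentation \<in> carrier_vec (length (res_degrees 0))" by (simp add: res_augmentation_def len)
  show "homogeneous (res_augmentation $ b) (res_degrees 0 ! b)" if "b < length (res_degrees 0)" for b
    using that by (simp add: res_augmentation_def res_degrees_def L_zero homogeneous_def)
  show "\<exists>v\<in>carrier_vec (length (res_degrees 0)). f - res_augmentation \<bullet> v \<in> monomial_ideal P" for f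
    by (rule bexI[of _ "vec_of 0 (\<lambda>_. f)"]) (simp_all add: augmentation_vec_of vec_of_carrier len monomial_ideal_def)
  show "{v \<in> carrier_vec (length (res_degrees 0)). res_augmentation \<bullet> v \<in> monomial_ideal P} = mat_image (res_matrix 0)"
  proof (intro subset_antisym subsetI)
    fix v assume "v \<in> {v \<in> carrier_vec (length (res_degrees 0)). res_augmentation \<bullet> v \<in> monomial_ideal P}"
    then have v: "v \<in> carrier_vec (length (L 0))" "res_augmentation \<bullet> v \<in> monomial_ideal P" by (auto simp: len)
    obtain p where p: "v = vec_of 0 p" "\<And>w. p w \<noteq> 0 \<Longrightarrow> w \<in> B \<and> h w = 0" using vec_of_surj[OF v(1)] by blast
    have "c u w = 0 \<or> p w = 0" for u w using p(2)[of w] fD(11)[of u w] by (cases "c u w = 0"; cases "p w = 0") auto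
    then have "poly_diff p u = 0" for u unfolding poly_diff_def by (intro sum.neutral) (metis mult_not_zero single_zero)
    moreover have "p {} \<in> monomial_ideal P" using v(2) by (simp add: p(1) augmentation_vec_of)
    ultimately obtain q where "\<forall>w. q w \<noteq> 0 \<longrightarrow> w \<in> B \<and> h w = Suc 0" "\<forall>v. poly_diff q v = p v"
      using poly_diff_exact[of p 0] p(2) by blast
    moreover from this have "v = vec_of 0 (poly_diff q)" unfolding p(1) vec_of_eq_iff by simp
    ultimately show "v \<in> mat_image (res_matrix 0)" unfolding image_iff by blast
  next
    fix v assume "v \<in> mat_image (res_matrix 0)"
    then obtain q where "v = vec_of 0 (poly_diff q)" unfolding image_iff by blast
    then show "v \<in> {v \<in> carrier_vec (length (res_degrees 0)). res_augmentation \<bullet> v \<in> monomial_ideal P}"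
      by (simp add: len vec_of_carrier augmentation_vec_of poly_diff_in_ideal)
  qed
  show "mat_kernel (res_matrix i) = mat_image (res_matrix (Suc i))" for i
  proof -
    have zero: "0\<^sub>v (length (L i)) = vec_of i (\<lambda>_. 0)" by (intro eq_vecI) (auto simp: vec_of_def)
    have ker: "v \<in> mat_kernel (res_matrix i) \<longleftrightarrow> v \<in> carrier_vec (length (L (Suc i))) \<and> res_matrix i *\<^sub>v v = 0\<^sub>v (length (L i))" for v
      unfolding mat_kernel[OF res_matrix_carrier] by blast
    show ?thesis
    proof (intro subset_antisym subsetI)
      fix v assume "v \<in> mat_kernel (res_matrix i)"
      then have v: "v \<in> carrier_vec (length (L (Suc i)))" "res_matrix i *\<^sub>v v = 0\<^sub>v (length (L i))" unfolding ker by auto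
      obtain p where p: "v = vec_of (Suc i) p" "\<And>w. p w \<noteq> 0 \<Longrightarrow> w \<in> B \<and> h w = Suc i" using vec_of_surj[OF v(1)] by blast
      have z: "\<forall>w\<in>B. h w = i \<longrightarrow> poly_diff p w = 0"
        using v(2) unfolding p(1) res_matrix_vec_of zero vec_of_eq_iff .
      have "poly_diff p u = 0" for u
        using z poly_diff_outside[of u p] poly_diff_supp[OF p(2)] by blast
      then obtain q where "\<forall>w. q w \<noteq> 0 \<longrightarrow> w \<in> B \<and> h w = Suc (Suc i)" "\<forall>v. poly_diff q v = p v"
        using poly_diff_exact[of p "Suc i"] p(2) by blast
      moreover from this have "v = vec_of (Suc i) (poly_diff q)" unfolding p(1) vec_of_eq_iff by simp
      ultimately show "v \<in> mat_image (res_matrix (Suc i))" unfolding image_iff by blast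
    next
      fix v assume "v \<in> mat_image (res_matrix (Suc i))"
      then obtain q where "v = vec_of (Suc i) (poly_diff q)" unfolding image_iff by blast
      then show "v \<in> mat_kernel (res_matrix i)"
        unfolding ker by (simp add: vec_of_carrier res_matrix_vec_of zero vec_of_eq_iff poly_diff_poly_diff)
    qed
  qed
  show "Poly_Mapping.lookup (res_matrix i $$ (a, b)) 0 = 0" if ab: "a < length (res_degrees i)" "b < length (res_degrees (Suc i))" for i a b
  proof -
    define v w where "v = L i ! a" and "w = L (Suc i) ! b"
    have fin: "finite w" using L_nth[of b "Suc i"] ab(2) fD(3) by (auto simp: w_def len)
    have "squarefree_exponent (w - v) \<noteq> 0" if "c v w \<noteq> 0"
    proof -
      have "w - v \<noteq> {}" using fD(10)[OF that] by blast
      then show ?thesis using keys_squarefree_exponent[of "w - v"] fin by auto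
    qed
    then have "Poly_Mapping.lookup (Poly_Mapping.single (squarefree_exponent (w - v)) (c v w)) 0 = 0"
      by (auto simp: lookup_single when_def)
    then show ?thesis using ab by (simp add: res_matrix_def v_def w_def len)
  qed
qed

end

text \<open>The scalars \<open>c\<close> drop out: homological degrees and sizes of the multidegrees
  suffice, which makes the answer independent of the field.\<close>

theorem graded_betti_frame:
  assumes F: "frame P B h (c :: 'v set \<Rightarrow> 'v set \<Rightarrow> 'k::field)"
  shows "graded_betti (monomial_ideal P :: ('v, 'k) mpoly set) i j = card {w \<in> B. h w = i \<and> int (card w) = j}"
    and "resolution_degrees (monomial_ideal P :: ('v, 'k) mpoly set) i \<noteq> [] \<longleftrightarrow> i \<in> h ` B"
proof -
  have "\<forall>i. \<exists>xs. set xs = {w \<in> B. h w = i} \<and> distinct xs"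
    using frameD(2)[OF F] by (intro allI finite_distinct_list) simp
  from choice[OF this] obtain L where "\<And>i. set (L i) = {w \<in> B. h w = i}" "\<And>i. distinct (L i)" by blast
  then interpret listed_frame P B h c L by unfold_locales (use F in auto)
  have hom: "homogeneous_ideal (monomial_ideal P :: ('v, 'k) mpoly set)"
    using fD(1) by (rule homogeneous_monomial_ideal)
  note eq = graded_betti_eq_count[OF hom minimal_resolution]
  show b: "graded_betti (monomial_ideal P :: ('v, 'k) mpoly set) i j = card {w \<in> B. h w = i \<and> int (card w) = j}" for i j
  proof -
    have "count_list (res_degrees i) j = length (filter (\<lambda>w. int (card w) = j) (L i))"
      unfolding res_degrees_def by (induction "L i" ) (simp_all add: count_list_card length_filter_conv_card cong: conj_cong)
    also have "\<dots> = card (set (filter (\<lambda>w. int (card w) = j) (L i)))"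
      using distinct_card[of "filter (\<lambda>w. int (card w) = j) (L i)"] distinct_L by simp
    also have "set (filter (\<lambda>w. int (card w) = j) (L i)) = {w \<in> B. h w = i \<and> int (card w) = j}"
      using set_L by auto
    finally show ?thesis by (simp add: eq)
  qed
  \<comment> \<open>The chosen resolution is accessible only through its degree counts, so a
    nonempty module is recognized by a nonzero Betti number.\<close>
  show "resolution_degrees (monomial_ideal P :: ('v, 'k) mpoly set) i \<noteq> [] \<longleftrightarrow> i \<in> h ` B"
  proof
    assume "resolution_degrees (monomial_ideal P :: ('v, 'k) mpoly set) i \<noteq> []"
    then obtain j where "j \<in> set (resolution_degrees (monomial_ideal P :: ('v, 'k) mpoly set) i)"
      by (metis list.set_intros(1) neq_Nil_conv)
    then have "graded_betti (monomial_ideal P :: ('v, 'k) mpoly set) i j \<noteq> 0"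
      by (simp add: graded_betti_def count_list_0_iff)
    then have "{w \<in> B. h w = i \<and> int (card w) = j} \<noteq> {}" unfolding b by (metis card.empty)
    then show "i \<in> h ` B" by blast
  next
    assume "i \<in> h ` B"
    then obtain w where "w \<in> B" "h w = i" by blast
    then have "graded_betti (monomial_ideal P :: ('v, 'k) mpoly set) i (int (card w)) \<noteq> 0"
      unfolding b using fD(2) by auto
    then show "resolution_degrees (monomial_ideal P :: ('v, 'k) mpoly set) i \<noteq> []"
      by (auto simp: graded_betti_def)
  qed
qed

section \<open>The frame of the edge ideal\<close>

text \<open>Vertices are named by natural numbers to allow arithmetic on indices; since the
  abstraction maps are unspecified outside the index ranges, the injectivity lemmas carry range
  conditions.\<close>

definition vx :: "nat \<Rightarrow> H0_vertex" where "vx a = X (x_index_of_nat a)"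

definition vy :: "nat \<Rightarrow> H0_vertex" where "vy b = Y (y_index_of_nat b)"

lemma vx_eq_iff: "a \<in> {1..15} \<Longrightarrow> a' \<in> {1..15} \<Longrightarrow> vx a = vx a' \<longleftrightarrow> a = a'"
  by (simp add: vx_def x_index_of_nat_inject)

lemma vy_eq_iff: "b \<in> {3..16} \<Longrightarrow> b' \<in> {3..16} \<Longrightarrow> vy b = vy b' \<longleftrightarrow> b = b'"
  by (simp add: vy_def y_index_of_nat_inject)

lemma vx_neq_vy: "vx a \<noteq> vy b" "vy b \<noteq> vx a"
  by (auto simp: vx_def vy_def)

lemma vx_in_image_iff: "a \<in> {1..15} \<Longrightarrow> N \<subseteq> {1..15} \<Longrightarrow> vx a \<in> vx ` N \<longleftrightarrow> a \<in> N"
  using vx_eq_iff by blast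

lemma vy_in_image_iff: "b \<in> {3..16} \<Longrightarrow> N \<subseteq> {3..16} \<Longrightarrow> vy b \<in> vy ` N \<longleftrightarrow> b \<in> N"
  using vy_eq_iff by blast

text \<open>The edge sets arising in the colon ideals: the edge x_a y_b leads to
  \<open>A = b\<close> and \<open>C = H0_M a\<close>. The bound \<open>A\<close> is inclusive and
  \<open>C\<close> exclusive, and \<open>edge_range 0 0\<close> is the whole graph.\<close>

definition edge_range :: "nat \<Rightarrow> nat \<Rightarrow> (nat \<times> nat) set" where
  "edge_range A C = {(a, b). a \<in> {1..15} \<and> H0_m a \<le> b \<and> b \<le> H0_M a \<and> A \<le> a \<and> C < b}"

lemma edge_range_bounds:
  assumes "(a, b) \<in> edge_range A C"
  shows "1 \<le> a" "a \<le> 15" "a < b" "3 \<le> b" "b \<le> 16" "b \<le> H0_M a" "H0_M a \<le> 16" "A \<le> a" "C < b"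
  using assms unfolding edge_range_def H0_m_def H0_M_def by (auto split: if_splits)

lemma finite_edge_range: "finite (edge_range A C)"
proof (rule finite_subset)
  show "edge_range A C \<subseteq> {1..15} \<times> {3..16}"
    using edge_range_bounds by auto
qed auto

definition contains_edge :: "(nat \<times> nat) set \<Rightarrow> H0_vertex set \<Rightarrow> bool" where
  "contains_edge S U \<longleftrightarrow> (\<exists>(a, b)\<in>S. vx a \<in> U \<and> vy b \<in> U)"

definition quadrant :: "nat \<Rightarrow> nat \<Rightarrow> H0_vertex set" where
  "quadrant a b = vx ` {a..15} \<union> vy ` {b..16}"

text \<open>The corner \<open>(a, b)\<close> of a multidegree is the edge whose mapping cone introduced it.\<close>

definition has_corner :: "(nat \<times> nat) set \<Rightarrow> H0_vertex set \<Rightarrow> bool" where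
  "has_corner S w \<longleftrightarrow> (\<exists>(a, b)\<in>S. vx a \<in> w \<and> vy b \<in> w \<and> w \<subseteq> quadrant a b)"

text \<open>
  \<open>betti_position A C i r\<close>: the edge ideal of \<open>edge_range A C\<close> has a nonzero Betti number in column \<open>i\<close>
  and row \<open>r\<close>. In the recursion \<open>k\<close> counts the chosen variables among the \<open>M(a) - a - 1\<close> in the colon
  ideal.
\<close>

inductive betti_position :: "nat \<Rightarrow> nat \<Rightarrow> nat \<Rightarrow> nat \<Rightarrow> bool" where
  zero: "betti_position A C 0 0"
| step: "(a, b) \<in> edge_range A C \<Longrightarrow> k \<le> H0_M a - a - 1 \<Longrightarrow> betti_position b (H0_M a) i r
    \<Longrightarrow> betti_position A C (i + 1 + k) (r + 1)"

text \<open>One unfolding of the recursion for an arbitrary edge set. It is needed for the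
  intermediate stages, which are not of the form \<open>edge_range A C\<close>.\<close>

definition edge_positions :: "(nat \<times> nat) set \<Rightarrow> nat \<Rightarrow> nat \<Rightarrow> bool" where
  "edge_positions S i r \<longleftrightarrow> i = 0 \<and> r = 0 \<or>
     (\<exists>a b k i' r'. (a, b) \<in> S \<and> k \<le> H0_M a - a - 1 \<and> betti_position b (H0_M a) i' r' \<and>
        i = i' + 1 + k \<and> r = r' + 1)"

lemma edge_positions_edge_range: "edge_positions (edge_range A C) i r = betti_position A C i r"
  unfolding edge_positions_def by (subst betti_position.simps) blast

lemma vx_in_quadrant_iff: "1 \<le> a \<Longrightarrow> 1 \<le> a' \<Longrightarrow> a \<le> 15 \<Longrightarrow> 3 \<le> b' \<Longrightarrow> vx a \<in> quadrant a' b' \<longleftrightarrow> a' \<le> a"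
  unfolding quadrant_def using vx_in_image_iff[of a "{a'..15}"] vx_neq_vy by auto

lemma vy_in_quadrant_iff: "1 \<le> a' \<Longrightarrow> 3 \<le> b \<Longrightarrow> b \<le> 16 \<Longrightarrow> 3 \<le> b' \<Longrightarrow> vy b \<in> quadrant a' b' \<longleftrightarrow> b' \<le> b"
  unfolding quadrant_def using vy_in_image_iff[of b "{b'..16}"] vx_neq_vy by auto

lemma quadrant_mono: "a' \<le> a \<Longrightarrow> b' \<le> b \<Longrightarrow> quadrant a b \<subseteq> quadrant a' b'"
  unfolding quadrant_def by auto

text \<open>The edge sets present at intermediate stages. Removing the least element undoes the most
  recent cone.\<close>

definition lex_upper :: "nat \<Rightarrow> nat \<Rightarrow> (nat \<times> nat) set \<Rightarrow> bool" where
  "lex_upper A C S \<longleftrightarrow> S \<subseteq> edge_range A C \<and>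
     (\<forall>a b a' b'. (a, b) \<in> S \<longrightarrow> (a', b') \<in> edge_range A C \<longrightarrow> a < a' \<or> a = a' \<and> b < b' \<longrightarrow> (a', b') \<in> S)"

lemma lex_upper_remove_least:
  assumes S: "lex_upper A C S" "S \<noteq> {}"
  obtains a b where "(a, b) \<in> S" "lex_upper A C (S - {(a, b)})"
    "\<And>a' b'. (a', b') \<in> S - {(a, b)} \<Longrightarrow> a < a' \<or> a = a' \<and> b < b'"
proof -
  have fin: "finite S" using S(1) finite_edge_range finite_subset unfolding lex_upper_def by blast
  define a where "a = Min (fst ` S)"
  have a: "a \<in> fst ` S" "\<And>a' b'. (a', b') \<in> S \<Longrightarrow> a \<le> a'"
    unfolding a_def using fin S(2) by (auto intro!: Min_in Min_le) (force)
  define b where "b = Min {b. (a, b) \<in> S}"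
  have finb: "finite {b. (a, b) \<in> S}"
    by (rule finite_subset[of _ "snd ` S"]) (use fin in force)+
  have ne: "{b. (a, b) \<in> S} \<noteq> {}" using a(1) by auto
  have b: "(a, b) \<in> S" "\<And>b'. (a, b') \<in> S \<Longrightarrow> b \<le> b'"
    using Min_in[OF finb ne] Min_le[OF finb] unfolding b_def by auto
  have least: "a < a' \<or> a = a' \<and> b < b'" if "(a', b') \<in> S - {(a, b)}" for a' b'
  proof -
    have "a \<le> a'" using a(2) that by auto
    moreover have "b < b'" if "a' = a" using b(2)[of b'] \<open>(a', b') \<in> S - {(a, b)}\<close> that by (cases "b = b'") auto
    ultimately show ?thesis by linarith
  qed
  moreover have "lex_upper A C (S - {(a, b)})"
    unfolding lex_upper_def
  proof (intro conjI allI impI)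
    show "S - {(a, b)} \<subseteq> edge_range A C" using S(1) unfolding lex_upper_def by blast
    fix a1 b1 a' b' assume h: "(a1, b1) \<in> S - {(a, b)}" "(a', b') \<in> edge_range A C" "a1 < a' \<or> a1 = a' \<and> b1 < b'"
    have "(a', b') \<in> S" using S(1) h unfolding lex_upper_def by blast
    moreover have "(a', b') \<noteq> (a, b)" using least[OF h(1)] h(3) by auto
    ultimately show "(a', b') \<in> S - {(a, b)}" by blast
  qed
  ultimately show thesis using that b(1) by blast
qed

text \<open>The variables of the colon ideal: the x strictly between a and b, which are neighbors of
  y_b, and the later neighbors of x_a. Their numbers b - 1 - a and M(a) - b have a sum free of
  b.\<close>

definition link_vars :: "nat \<Rightarrow> nat \<Rightarrow> H0_vertex set" where
  "link_vars a b = vx ` {a<..b - 1} \<union> vy ` {b<..H0_M a}"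

lemma card_link_vars:
  assumes "(a, b) \<in> edge_range A C"
  shows "card (link_vars a b) = H0_M a - a - 1"
proof -
  note e = edge_range_bounds[OF assms]
  have "card (link_vars a b) = card (vx ` {a<..b - 1}) + card (vy ` {b<..H0_M a})"
    unfolding link_vars_def using vx_neq_vy by (intro card_Un_disjoint) auto
  also have "card (vx ` {a<..b - 1}) = card {a<..b - 1}"
    by (rule card_image) (use e in \<open>auto simp: inj_on_def vx_eq_iff\<close>)
  also have "card (vy ` {b<..H0_M a}) = card {b<..H0_M a}"
    by (rule card_image) (use e in \<open>auto simp: inj_on_def vy_eq_iff\<close>)
  finally show ?thesis using e by simp
qed

text \<open>Once x_a and y_b are present, an earlier edge x_a' y_t either has an end in
  \<open>link_vars a b\<close> or satisfies a' >= b and t > M(a). Conversely each link variable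
  forms an earlier edge with x_a or y_b.\<close>

lemma contains_edge_colon:
  assumes S: "lex_upper A C S" and ab: "(a, b) \<in> S"
    and least: "\<And>a' b'. (a', b') \<in> S - {(a, b)} \<Longrightarrow> a < a' \<or> a = a' \<and> b < b'"
    and U: "vx a \<in> U" "vy b \<in> U"
  shows "contains_edge (S - {(a, b)}) U \<longleftrightarrow>
    contains_edge (edge_range b (H0_M a)) U \<or> link_vars a b \<inter> U \<noteq> {}"
proof -
  have sub: "S \<subseteq> edge_range A C" using S unfolding lex_upper_def by blast
  have abr: "(a, b) \<in> edge_range A C" using sub ab by blast
  note e = edge_range_bounds[OF abr]
  have up: "(a', b') \<in> S - {(a, b)}" if "(a', b') \<in> edge_range A C" "a < a' \<or> a = a' \<and> b < b'" for a' b'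
  proof -
    have "(a', b') \<in> S" using S ab that unfolding lex_upper_def by blast
    then show ?thesis using that(2) by auto
  qed
  have M: "H0_M a \<le> H0_M a'" if "a \<le> a'" for a' using that e(1) unfolding H0_M_def by auto
  show ?thesis
  proof
    assume "contains_edge (S - {(a, b)}) U"
    then obtain a' t where t: "(a', t) \<in> S - {(a, b)}" "vx a' \<in> U" "vy t \<in> U"
      unfolding contains_edge_def by auto
    have r: "(a', t) \<in> edge_range A C" using t sub by blast
    note e' = edge_range_bounds[OF r]
    from least[OF t(1)] show "contains_edge (edge_range b (H0_M a)) U \<or> link_vars a b \<inter> U \<noteq> {}"
    proof
      assume "a = a' \<and> b < t"
      then have "vy t \<in> link_vars a b" using e' unfolding link_vars_def by auto
      then show ?thesis using t by blast
    next
      assume aa: "a < a'"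
      show ?thesis
      proof (cases "a' < b")
        case True
        then have "vx a' \<in> link_vars a b" using aa unfolding link_vars_def by auto
        then show ?thesis using t by blast
      next
        case False
        show ?thesis
        proof (cases "t \<le> H0_M a")
          case True
          \<comment> \<open>Here \<open>t > a' \<ge> b\<close>, so \<open>t\<close> lies strictly
            beyond \<open>b\<close>.\<close>
          then have "vy t \<in> link_vars a b" using False e' unfolding link_vars_def by auto
          then show ?thesis using t by blast
        next
          case F: False
          then have "(a', t) \<in> edge_range b (H0_M a)" using r False unfolding edge_range_def by auto
          then show ?thesis using t unfolding contains_edge_def by blast
        qed
      qed
    qed
  next
    assume "contains_edge (edge_range b (H0_M a)) U \<or> link_vars a b \<inter> U \<noteq> {}"
    then consider a' t where "(a', t) \<in> edge_range b (H0_M a)" "vx a' \<in> U" "vy t \<in> U"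
      | a' where "a < a'" "a' \<le> b - 1" "vx a' \<in> U" | t where "b < t" "t \<le> H0_M a" "vy t \<in> U"
      unfolding contains_edge_def link_vars_def by auto
    then show "contains_edge (S - {(a, b)}) U"
    proof cases
      case 1
      have "(a', t) \<in> edge_range A C" using 1(1) e unfolding edge_range_def by auto
      moreover have "a < a'" using edge_range_bounds[OF 1(1)] e by auto
      ultimately show ?thesis using up 1 unfolding contains_edge_def by blast
    next
      case 2
      \<comment> \<open>The left end is \<open>a' + 1 \<le> b\<close>, and
        \<open>b \<le> H0_M a \<le> H0_M a'\<close> because the right ends never decrease.\<close>
      have "(a', b) \<in> edge_range A C" using 2 e M[of a'] unfolding edge_range_def H0_m_def by auto
      then show ?thesis using up[of a' b] 2 U unfolding contains_edge_def by blast
    next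
      case 3
      have "(a, t) \<in> edge_range A C" using 3 abr unfolding edge_range_def by auto
      then show ?thesis using up[of a t] 3 U unfolding contains_edge_def by blast
    qed
  qed
qed

text \<open>The induction needs both the set without its last edge and the range in the colon ideal.
  Corners are carried along to keep new multidegrees apart from old ones, and
  \<open>h w \<le> card w\<close> so that rows are natural numbers.\<close>

lemma edge_frame:
  assumes "lex_upper A C S"
  shows "\<exists>B h. \<exists>c :: H0_vertex set \<Rightarrow> H0_vertex set \<Rightarrow> 'k::field. frame (contains_edge S) B h c \<and>
    (\<forall>w\<in>B. w \<noteq> {} \<longrightarrow> has_corner S w) \<and> (\<forall>w\<in>B. h w \<le> card w) \<and>
    (\<forall>i r. (\<exists>w\<in>B. h w = i \<and> card w = i + r) \<longleftrightarrow> edge_positions S i r)"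
  using assms
proof (induction "card S" arbitrary: A C S rule: less_induct)
  case less
  have sub: "S \<subseteq> edge_range A C" using less.prems unfolding lex_upper_def by blast
  have fin: "finite S" using sub finite_edge_range finite_subset by blast
  show ?case
  proof (cases "S = {}")
    case True
    have "contains_edge S = (\<lambda>_. False)" by (auto simp: contains_edge_def True)
    then show ?thesis using frame_trivial
      by (intro exI[of _ "{{}}"] exI[of _ "\<lambda>_. 0"] exI[of _ "\<lambda>_ _. 0"]) (auto simp: edge_positions_def True)
  next
    case False
    obtain a b where ab: "(a, b) \<in> S" and S': "lex_upper A C (S - {(a, b)})"
      and least: "\<And>a' b'. (a', b') \<in> S - {(a, b)} \<Longrightarrow> a < a' \<or> a = a' \<and> b < b'"
      using lex_upper_remove_least[OF less.prems False] by blast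
    have abr: "(a, b) \<in> edge_range A C" using sub ab by blast
    note e = edge_range_bounds[OF abr]
    define S' where "S' = S - {(a, b)}"
    define R where "R = edge_range b (H0_M a)"
    \<comment> \<open>The edges of \<open>R\<close> start at index \<open>b\<close> or later, hence
      beyond \<open>a\<close>, so they were added before. This also makes \<open>R\<close> small
      enough for the induction hypothesis.\<close>
    have RS: "R \<subseteq> S'"
    proof
      fix p assume p: "p \<in> R"
      obtain a' t where pp: "p = (a', t)" by (cases p)
      have q: "(a', t) \<in> edge_range b (H0_M a)" using p unfolding R_def pp .
      have "a < a'" using edge_range_bounds[OF q] e by linarith
      moreover have "(a', t) \<in> edge_range A C" using q e edge_range_bounds(3)[OF q] unfolding edge_range_def by auto
      ultimately show "p \<in> S'" using less.prems ab unfolding lex_upper_def S'_def pp by blast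
    qed
    have cS': "card S' < card S" unfolding S'_def using fin ab by (rule card_Diff1_less)
    have cR: "card R < card S" using card_mono[OF _ RS] cS' fin by (simp add: S'_def)
    have R: "lex_upper b (H0_M a) R" unfolding lex_upper_def R_def by blast
    from less.hyps[OF cS' S'[folded S'_def]] obtain B1 h1 and c1 :: "H0_vertex set \<Rightarrow> H0_vertex set \<Rightarrow> 'k" where
      IH1: "frame (contains_edge S') B1 h1 c1 \<and>
        (\<forall>w\<in>B1. w \<noteq> {} \<longrightarrow> has_corner S' w) \<and> (\<forall>w\<in>B1. h1 w \<le> card w) \<and>
        (\<forall>i r. (\<exists>w\<in>B1. h1 w = i \<and> card w = i + r) \<longleftrightarrow> edge_positions S' i r)"
      by (elim exE)
    then have F1: "frame (contains_edge S') B1 h1 c1"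
      and corner1: "\<And>w. w \<in> B1 \<Longrightarrow> w \<noteq> {} \<Longrightarrow> has_corner S' w"
      and le1: "\<And>w. w \<in> B1 \<Longrightarrow> h1 w \<le> card w"
      and pos1: "\<And>i r. (\<exists>w\<in>B1. h1 w = i \<and> card w = i + r) \<longleftrightarrow> edge_positions S' i r"
      by simp_all
    from less.hyps[OF cR R] obtain B0 h0 and c0 :: "H0_vertex set \<Rightarrow> H0_vertex set \<Rightarrow> 'k" where
      IH0: "frame (contains_edge R) B0 h0 c0 \<and>
        (\<forall>w\<in>B0. w \<noteq> {} \<longrightarrow> has_corner R w) \<and> (\<forall>w\<in>B0. h0 w \<le> card w) \<and>
        (\<forall>i r. (\<exists>w\<in>B0. h0 w = i \<and> card w = i + r) \<longleftrightarrow> edge_positions R i r)"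
      by (elim exE)
    then have F0: "frame (contains_edge R) B0 h0 c0"
      and corner0: "\<And>w. w \<in> B0 \<Longrightarrow> w \<noteq> {} \<Longrightarrow> has_corner R w"
      and le0: "\<And>w. w \<in> B0 \<Longrightarrow> h0 w \<le> card w"
      and pos0: "\<And>i r. (\<exists>w\<in>B0. h0 w = i \<and> card w = i + r) \<longleftrightarrow> edge_positions R i r"
      by simp_all
    define V where "V = link_vars a b"
    have finV: "finite V" by (simp add: V_def link_vars_def)
    \<comment> \<open>The corner of a nonempty multidegree from \<open>R\<close> has x-index at
      least b and y-index above M(a), whereas link variables have x-index below b or y-index at most
      M(a).\<close>
    have B0_quadrant: "w \<subseteq> quadrant b (Suc (H0_M a))" if wB: "w \<in> B0" for w
    proof (cases "w = {}")
      case False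
      then obtain a' b' where "(a', b') \<in> R" "w \<subseteq> quadrant a' b'" using corner0[OF wB] unfolding has_corner_def by blast
      then show ?thesis using quadrant_mono[of b a' "Suc (H0_M a)" b'] edge_range_bounds[of a' b' b "H0_M a"]
        unfolding R_def by (auto simp: Suc_le_eq)
    qed auto
    have V0: "w \<inter> V = {}" if "w \<in> B0" for w
    proof -
      have "quadrant b (Suc (H0_M a)) \<inter> V = {}"
        unfolding quadrant_def V_def link_vars_def using e vx_neq_vy by (auto simp: vx_eq_iff vy_eq_iff)
      then show ?thesis using B0_quadrant[OF that] by blast
    qed
    define B2 where "B2 = {w \<union> s | w s. w \<in> B0 \<and> s \<subseteq> V}"
    define h2 where "h2 w = h0 (w - V) + card (w \<inter> V)" for w
    obtain c2 :: "H0_vertex set \<Rightarrow> H0_vertex set \<Rightarrow> 'k" where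
      F2: "frame (\<lambda>U. contains_edge R U \<or> V \<inter> U \<noteq> {}) B2 h2 c2"
      using frame_add_vars[OF F0 finV V0] unfolding B2_def h2_def by blast
    have B2_quadrant: "w \<subseteq> quadrant (Suc a) (Suc b)" if "w \<in> B2" for w
    proof -
      have "quadrant b (Suc (H0_M a)) \<subseteq> quadrant (Suc a) (Suc b)" using e by (intro quadrant_mono) auto
      moreover have "V \<subseteq> quadrant (Suc a) (Suc b)"
        unfolding V_def link_vars_def quadrant_def using e by auto
      ultimately show ?thesis using that B0_quadrant unfolding B2_def by blast
    qed
    define ed where "ed = {vx a, vy b}"
    have disj: "w \<inter> ed = {}" if "w \<in> B2" for w
      using B2_quadrant[OF that] vx_in_quadrant_iff[of a "Suc a" "Suc b"] vy_in_quadrant_iff[of "Suc a" b "Suc b"] e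
      unfolding ed_def by auto
    have card2: "card (w \<union> ed) = card w + 2" if "w \<in> B2" for w
    proof -
      have "card ed = 2" unfolding ed_def using vx_neq_vy by simp
      then show ?thesis using card_Un_disjoint[OF _ _ disj[OF that]] frameD(3)[OF F2 that] by (simp add: ed_def)
    qed
    have corner2: "w \<union> ed \<subseteq> quadrant a b" if "w \<in> B2" for w
      using B2_quadrant[OF that] quadrant_mono[of a "Suc a" b "Suc b"] e unfolding ed_def quadrant_def by auto
    have new: "w \<union> ed \<notin> B1" if wB: "w \<in> B2" for w
    proof
      assume "w \<union> ed \<in> B1"
      then have "has_corner S' (w \<union> ed)" by (rule corner1) (simp add: ed_def)
      then obtain a' b' where ab': "(a', b') \<in> S'" "vx a' \<in> w \<union> ed" "vy b' \<in> w \<union> ed" "w \<union> ed \<subseteq> quadrant a' b'"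
        unfolding has_corner_def by blast
      have r': "(a', b') \<in> edge_range A C" using ab'(1) sub unfolding S'_def by blast
      note e' = edge_range_bounds[OF r']
      have "vx a \<in> quadrant a' b'" "vy b \<in> quadrant a' b'" using ab'(4) unfolding ed_def by auto
      then have "a' \<le> a" "b' \<le> b" using e e' by (simp_all add: vx_in_quadrant_iff vy_in_quadrant_iff)
      moreover have "vx a' \<in> quadrant a b" "vy b' \<in> quadrant a b" using ab'(2,3) corner2[OF wB] by auto
      then have "a \<le> a'" "b \<le> b'" using e e' by (simp_all add: vx_in_quadrant_iff vy_in_quadrant_iff)
      ultimately show False using ab'(1) unfolding S'_def by auto
    qed
    define B where "B = B1 \<union> (\<lambda>w. w \<union> ed) ` B2"
    define h where "h w = (if w \<in> B1 then h1 w else Suc (h2 (w - ed)))" for w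
    have "\<exists>c :: H0_vertex set \<Rightarrow> H0_vertex set \<Rightarrow> 'k. frame (\<lambda>U. contains_edge S' U \<or> ed \<subseteq> U) B h c"
      unfolding B_def h_def
    proof (rule frame_cone[OF F1 F2])
      show "finite ed" by (simp add: ed_def)
      show "contains_edge S' U \<longleftrightarrow> contains_edge R U \<or> V \<inter> U \<noteq> {}" if "ed \<subseteq> U" for U
        unfolding S'_def R_def V_def
        by (rule contains_edge_colon[OF less.prems ab least]) (use that in \<open>auto simp: ed_def\<close>)
    qed (use disj new in auto)
    moreover have "(\<lambda>U. contains_edge S' U \<or> ed \<subseteq> U) = contains_edge S"
      unfolding contains_edge_def S'_def ed_def using ab by (auto simp: fun_eq_iff)
    ultimately obtain c :: "H0_vertex set \<Rightarrow> H0_vertex set \<Rightarrow> 'k" where F: "frame (contains_edge S) B h c" by auto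
    have hw1: "h w = h1 w" if "w \<in> B1" for w using that by (simp add: h_def)
    \<comment> \<open>The size grows by \<open>card s + 2\<close> but the homological degree only by
      \<open>card s + 1\<close>: the edge accounts for one new row, and the link variables move
      along that row.\<close>
    have hw2: "h (w \<union> s \<union> ed) = Suc (h0 w + card s)" "card (w \<union> s \<union> ed) = card w + card s + 2" if "w \<in> B0" "s \<subseteq> V" for w s
    proof -
      have i: "w \<union> s \<in> B2" using that unfolding B2_def by blast
      have "(w \<union> s) - V = w" "(w \<union> s) \<inter> V = s" using V0[OF that(1)] that(2) by auto
      then have "h2 (w \<union> s) = h0 w + card s" by (simp add: h2_def)
      moreover have "(w \<union> s \<union> ed) - ed = w \<union> s" using disj[OF i] by auto
      ultimately show "h (w \<union> s \<union> ed) = Suc (h0 w + card s)" using new[OF i] by (simp add: h_def)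
      have "w \<inter> s = {}" "finite s" using V0[OF that(1)] that(2) finV finite_subset by auto
      then show "card (w \<union> s \<union> ed) = card w + card s + 2"
        using card2[OF i] card_Un_disjoint[OF frameD(3)[OF F0 that(1)]] by simp
    qed
    have cases: "w \<in> B \<longleftrightarrow> w \<in> B1 \<or> (\<exists>w0\<in>B0. \<exists>s\<subseteq>V. w = w0 \<union> s \<union> ed)" for w
      unfolding B_def B2_def by blast
    have cornerB: "has_corner S w" if w: "w \<in> B" "w \<noteq> {}" for w
    proof (cases "w \<in> B1")
      case True
      then show ?thesis using corner1[OF True w(2)] unfolding has_corner_def S'_def by blast
    next
      case False
      then obtain w2 where "w2 \<in> B2" "w = w2 \<union> ed" using w unfolding B_def by blast
      then have "w \<subseteq> quadrant a b" "vx a \<in> w" "vy b \<in> w" using corner2 by (auto simp: ed_def)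
      then show ?thesis using ab unfolding has_corner_def by blast
    qed
    have leB: "h w \<le> card w" if "w \<in> B" for w
    proof (cases "w \<in> B1")
      case False
      then obtain w0 s where "w0 \<in> B0" "s \<subseteq> V" "w = w0 \<union> s \<union> ed" using \<open>w \<in> B\<close> cases by blast
      then show ?thesis using le0[of w0] hw2[of w0 s] by simp
    qed (simp add: hw1 le1)
    have k_iff: "(\<exists>s\<subseteq>V. card s = k) \<longleftrightarrow> k \<le> H0_M a - a - 1" for k
      using card_link_vars[OF abr] obtain_subset_with_card_n[of k V] card_mono[OF finV] unfolding V_def by metis
    have posB: "(\<exists>w\<in>B. h w = i \<and> card w = i + r) \<longleftrightarrow> edge_positions S i r" for i r
    proof -
      have "(\<exists>w\<in>B. Q w) \<longleftrightarrow> (\<exists>w\<in>B1. Q w) \<or> (\<exists>w\<in>B0. \<exists>s\<subseteq>V. Q (w \<union> s \<union> ed))" for Q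
        using cases by blast
      then have "(\<exists>w\<in>B. h w = i \<and> card w = i + r) \<longleftrightarrow> (\<exists>w\<in>B1. h w = i \<and> card w = i + r) \<or>
        (\<exists>w\<in>B0. \<exists>s\<subseteq>V. h (w \<union> s \<union> ed) = i \<and> card (w \<union> s \<union> ed) = i + r)" .
      also have "\<dots> \<longleftrightarrow> (\<exists>w\<in>B1. h1 w = i \<and> card w = i + r) \<or>
        (\<exists>w\<in>B0. \<exists>s\<subseteq>V. Suc (h0 w + card s) = i \<and> card w + card s + 2 = i + r)"
        by (simp only: hw1 hw2 cong: bex_cong conj_cong)
      also have "(\<exists>w\<in>B0. \<exists>s\<subseteq>V. Suc (h0 w + card s) = i \<and> card w + card s + 2 = i + r) \<longleftrightarrow>
        (\<exists>k i' r'. k \<le> H0_M a - a - 1 \<and> (\<exists>w\<in>B0. h0 w = i' \<and> card w = i' + r') \<and> i = i' + 1 + k \<and> r = r' + 1)"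
        (is "?L \<longleftrightarrow> ?R")
      proof
        assume ?L
        then obtain w s where ws: "w \<in> B0" "s \<subseteq> V" "Suc (h0 w + card s) = i" "card w + card s + 2 = i + r" by blast
        have "card s \<le> H0_M a - a - 1" using k_iff ws(2) by blast
        moreover have "card w = h0 w + (card w - h0 w)" using le0[OF ws(1)] by simp
        moreover have "i = h0 w + 1 + card s" "r = (card w - h0 w) + 1" using ws(3,4) le0[OF ws(1)] by auto
        ultimately show ?R using ws(1) by blast
      next
        assume ?R
        then obtain k i' r' w where k: "k \<le> H0_M a - a - 1" "w \<in> B0" "h0 w = i'" "card w = i' + r'" "i = i' + 1 + k" "r = r' + 1" by blast
        obtain s where "s \<subseteq> V" "card s = k" using k_iff k(1) by blast
        then show ?L using k by (intro bexI[of _ w] exI[of _ s]) auto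
      qed
      finally have eq: "(\<exists>w\<in>B. h w = i \<and> card w = i + r) \<longleftrightarrow> edge_positions S' i r \<or> (\<exists>k i' r'.
        k \<le> H0_M a - a - 1 \<and> betti_position b (H0_M a) i' r' \<and> i = i' + 1 + k \<and> r = r' + 1)"
        unfolding pos1 pos0 R_def edge_positions_edge_range .
      \<comment> \<open>With \<open>i\<close> and \<open>r\<close> fixed, \<open>T\<close> is the
        contribution of a single edge, so inserting an edge adds one disjunct.\<close>
      define T where "T = (\<lambda>(a, b). \<exists>k i' r'.
        k \<le> H0_M a - a - 1 \<and> betti_position b (H0_M a) i' r' \<and> i = i' + 1 + k \<and> r = r' + 1)"
      have T: "edge_positions Z i r \<longleftrightarrow> i = 0 \<and> r = 0 \<or> (\<exists>p\<in>Z. T p)" for Z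
        unfolding edge_positions_def T_def by (simp add: Bex_def split_paired_Ex)
      have "S = insert (a, b) S'" unfolding S'_def using ab by auto
      then have "edge_positions S i r \<longleftrightarrow> edge_positions S' i r \<or> T (a, b)" unfolding T by blast
      then show ?thesis unfolding eq by (simp add: T_def)
    qed
    show ?thesis using F cornerB leB posB
      by (intro exI[of _ B] exI[of _ h] exI[of _ c]) simp
  qed
qed

section \<open>Positions of the nonzero Betti numbers\<close>

lemma H0_M_cases:
  assumes "1 \<le> a" "a \<le> 15"
  obtains "a = 1" "H0_M a = 4" | "a = 2" "H0_M a = 8" | "3 \<le> a" "a \<le> 7" "H0_M a = 13"
    | "a = 8" "H0_M a = 14" | "9 \<le> a" "H0_M a = 16"
  using assms unfolding H0_M_def by force

text \<open>Each recursive call raises \<open>C\<close> to some M(a), one of 4, 8, 13, 14, 16. The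
  bounds are therefore computed downwards from 16, beyond which no edge exists.\<close>

lemma betti_position_16:
  assumes "betti_position A C i r" "16 \<le> C"
  shows "i = 0 \<and> r = 0"
  using assms(1)
proof cases
  case (step a b k i' r')
  then show ?thesis using edge_range_bounds[OF step(3)] assms(2) by simp
qed simp

text \<open>Only a >= 9 reaches beyond y_14, and the chain then stops, leaving at most 16 - a
  columns: 7 in general and 2 from a = 14 on.\<close>

lemma betti_position_14:
  assumes "betti_position A C i r" "14 \<le> C"
  shows "i \<le> 7 \<and> r \<le> 1 \<and> (14 \<le> A \<longrightarrow> i \<le> 2)"
  using assms(1)
proof cases
  case (step a b k i' r')
  note e = edge_range_bounds[OF step(3)]
  have "9 \<le> a \<and> H0_M a = 16"
    using e assms(2) by (cases rule: H0_M_cases[OF e(1,2)]) auto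
  moreover from this have "i' = 0 \<and> r' = 0" using betti_position_16[OF step(5)] by simp
  ultimately show ?thesis using step e by auto
qed auto

text \<open>A second edge is possible only after a = 8, which forces b = 14 and gives 6 + 2 columns;
  a start at a >= 9 ends at once with at most 7.\<close>

lemma betti_position_13:
  assumes "betti_position A C i r" "13 \<le> C"
  shows "i \<le> 8 \<and> r \<le> 2 \<and> (9 \<le> A \<longrightarrow> i \<le> 7 \<and> r \<le> 1)"
  using assms(1)
proof cases
  case (step a b k i' r')
  note e = edge_range_bounds[OF step(3)]
  show ?thesis
  proof (cases rule: H0_M_cases[OF e(1,2)])
    case 4
    then have "b = 14" using e assms(2) by simp
    then show ?thesis using betti_position_14[OF step(5)] step e 4 by auto
  next
    case 5
    then show ?thesis using betti_position_16[OF step(5)] step e by auto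
  qed (use e assms(2) in auto)
qed auto

text \<open>The extreme case starts at a = 3. Then b > 8 sends the recursion to
  \<open>A \<ge> 9\<close>, where a = 8 is lost: 10 + 7 columns and only two rows.\<close>

lemma betti_position_8:
  assumes "betti_position A C i r" "8 \<le> C" "3 \<le> A"
  shows "i \<le> 17 \<and> r \<le> 2"
  using assms(1)
proof cases
  case (step a b k i' r')
  note e = edge_range_bounds[OF step(3)]
  show ?thesis
  proof (cases rule: H0_M_cases[OF e(1,2)])
    case 3
    then show ?thesis using betti_position_13[OF step(5)] step e assms(2) by auto
  next
    case 4
    then show ?thesis using betti_position_14[OF step(5)] step e by auto
  next
    case 5
    then show ?thesis using betti_position_16[OF step(5)] step e by auto
  qed (use e assms(3) in auto)
qed auto

text \<open>Here b may be small, so after a = 3 the continuation through a = 8 stays available: 10 +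
  8 columns and three rows.\<close>

lemma betti_position_4:
  assumes "betti_position A C i r" "3 \<le> A"
  shows "i \<le> 18 \<and> r \<le> 3"
  using assms(1)
proof cases
  case (step a b k i' r')
  note e = edge_range_bounds[OF step(3)]
  show ?thesis
  proof (cases rule: H0_M_cases[OF e(1,2)])
    case 3
    then show ?thesis using betti_position_13[OF step(5)] step e by auto
  next
    case 4
    then show ?thesis using betti_position_14[OF step(5)] step e by auto
  next
    case 5
    then show ?thesis using betti_position_16[OF step(5)] step e by auto
  qed (use e assms(2) in auto)
qed auto

text \<open>The first edge decides: a = 1 allows 3 + 18 columns and four rows, a = 2 allows 6 + 17
  columns but three rows, and later starts reach neither bound.\<close>

lemma betti_position_bounds:
  assumes "betti_position A C i r"
  shows "i \<le> 23 \<and> r \<le> 4 \<and> (4 \<le> r \<longrightarrow> i \<le> 21)"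
  using assms
proof cases
  case (step a b k i' r')
  note e = edge_range_bounds[OF step(3)]
  show ?thesis
  proof (cases rule: H0_M_cases[OF e(1,2)])
    case 1
    then show ?thesis using betti_position_4[OF step(5)] step e by auto
  next
    case 2
    then show ?thesis using betti_position_8[OF step(5)] step e by auto
  next
    case 3
    then show ?thesis using betti_position_13[OF step(5)] step e by auto
  next
    case 4
    then show ?thesis using betti_position_14[OF step(5)] step e by auto
  next
    case 5
    then show ?thesis using betti_position_16[OF step(5)] step e by auto
  qed
qed auto

text \<open>The chain (2,3), (3,9), (9,14), with all link variables chosen at each edge: 6 + 10 + 7
  columns.\<close>

lemma betti_position_23_3: "betti_position 0 0 23 3"
proof -
  have "betti_position 9 13 7 1"
    using betti_position.step[of 9 14 9 13 6 0 0] betti_position.zero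
    by (simp add: edge_range_def H0_m_def H0_M_def)
  then have "betti_position 3 8 17 2"
    using betti_position.step[of 3 9 3 8 9 7 1] by (simp add: edge_range_def H0_m_def H0_M_def numeral_2_eq_2)
  then show ?thesis
    using betti_position.step[of 2 3 0 0 5 17 2] by (simp add: edge_range_def H0_m_def H0_M_def)
qed

text \<open>The chain (1,3), (3,5), (8,14), (14,15), again with all link variables: 3 + 10 + 6 + 2
  columns.\<close>

lemma betti_position_21_4: "betti_position 0 0 21 4"
proof -
  have "betti_position 14 14 2 1"
    using betti_position.step[of 14 15 14 14 1 0 0] betti_position.zero
    by (simp add: numeral_2_eq_2 edge_range_def H0_m_def H0_M_def)
  then have "betti_position 5 13 8 2"
    using betti_position.step[of 8 14 5 13 5 2 1] by (simp add: edge_range_def H0_m_def H0_M_def numeral_2_eq_2)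
  then have "betti_position 3 4 18 3"
    using betti_position.step[of 3 5 3 4 9 8 2] by (simp add: edge_range_def H0_m_def H0_M_def)
  then show ?thesis
    using betti_position.step[of 1 3 0 0 2 18 3] by (simp add: edge_range_def H0_m_def H0_M_def)
qed

lemma contains_edge_H0:
  "contains_edge (edge_range 0 0) U \<longleftrightarrow> (\<exists>u v. u \<noteq> v \<and> {u, v} \<in> H0 \<and> u \<in> U \<and> v \<in> U)"
proof
  assume "contains_edge (edge_range 0 0) U"
  then obtain a b where ab: "(a, b) \<in> edge_range 0 0" "vx a \<in> U" "vy b \<in> U"
    unfolding contains_edge_def by blast
  note e = edge_range_bounds[OF ab(1)]
  have "nat_of_x_index (x_index_of_nat a) = a" "nat_of_y_index (y_index_of_nat b) = b"
    using e by (simp_all add: x_index_of_nat_inverse y_index_of_nat_inverse)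
  moreover have "H0_m a \<le> b" "b \<le> H0_M a" using ab(1) by (auto simp: edge_range_def)
  ultimately have "{vx a, vy b} \<in> H0" unfolding H0_def vx_def vy_def mem_Collect_eq
    by (intro exI[of _ "x_index_of_nat a"] exI[of _ "y_index_of_nat b"]) simp
  then show "\<exists>u v. u \<noteq> v \<and> {u, v} \<in> H0 \<and> u \<in> U \<and> v \<in> U"
    using ab(2,3) vx_neq_vy(1) by (intro exI[of _ "vx a"] exI[of _ "vy b"]) simp
next
  assume "\<exists>u v. u \<noteq> v \<and> {u, v} \<in> H0 \<and> u \<in> U \<and> v \<in> U"
  then obtain u v where uv: "{u, v} \<in> H0" "u \<in> U" "v \<in> U" by blast
  then obtain i t where it: "{u, v} = {X i, Y t}" "H0_m (nat_of_x_index i) \<le> nat_of_y_index t"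
    "nat_of_y_index t \<le> H0_M (nat_of_x_index i)" unfolding H0_def by blast
  \<comment> \<open>Working with the subset avoids deciding which of \<open>u\<close> and
    \<open>v\<close> is the x-vertex.\<close>
  have "{u, v} \<subseteq> U" using uv(2,3) by simp
  then have "X i \<in> U" "Y t \<in> U" unfolding it(1) by simp_all
  then have "vx (nat_of_x_index i) \<in> U" "vy (nat_of_y_index t) \<in> U"
    by (simp_all add: vx_def vy_def nat_of_x_index_inverse nat_of_y_index_inverse)
  moreover have "(nat_of_x_index i, nat_of_y_index t) \<in> edge_range 0 0"
    using it nat_of_x_index[of i] nat_of_y_index[of t] by (simp add: edge_range_def)
  ultimately show "contains_edge (edge_range 0 0) U" unfolding contains_edge_def by blast
qed

lemma edge_ideal_H0_betti:
  fixes I :: "(H0_vertex, 'k::field) mpoly set"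
  assumes "I = edge_ideal H0"
  shows "graded_betti I i j \<noteq> 0 \<longleftrightarrow> (\<exists>r. j = int i + int r \<and> betti_position 0 0 i r)"
    and "resolution_degrees I i \<noteq> [] \<longleftrightarrow> (\<exists>r. betti_position 0 0 i r)"
proof -
  have "lex_upper 0 0 (edge_range 0 0)" unfolding lex_upper_def by blast
  from edge_frame[OF this] obtain B h and c :: "H0_vertex set \<Rightarrow> H0_vertex set \<Rightarrow> 'k" where
    all: "frame (contains_edge (edge_range 0 0)) B h c \<and> (\<forall>w\<in>B. w \<noteq> {} \<longrightarrow> has_corner (edge_range 0 0) w) \<and>
      (\<forall>w\<in>B. h w \<le> card w) \<and> (\<forall>i r. (\<exists>w\<in>B. h w = i \<and> card w = i + r) \<longleftrightarrow> edge_positions (edge_range 0 0) i r)"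
    by (elim exE)
  then have F: "frame (contains_edge (edge_range 0 0)) B h c" and le: "\<And>w. w \<in> B \<Longrightarrow> h w \<le> card w"
    and pos: "\<And>i r. (\<exists>w\<in>B. h w = i \<and> card w = i + r) \<longleftrightarrow> betti_position 0 0 i r"
    unfolding edge_positions_edge_range by simp_all
  have I: "I = monomial_ideal (contains_edge (edge_range 0 0))"
    unfolding assms edge_ideal_eq_monomial_ideal contains_edge_H0 ..
  have "graded_betti I i j \<noteq> 0 \<longleftrightarrow> (\<exists>w\<in>B. h w = i \<and> int (card w) = j)"
    unfolding I graded_betti_frame(1)[OF F] using frameD(2)[OF F] by auto
  also have "\<dots> \<longleftrightarrow> (\<exists>r. j = int i + int r \<and> (\<exists>w\<in>B. h w = i \<and> card w = i + r))"
  proof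
    assume "\<exists>w\<in>B. h w = i \<and> int (card w) = j"
    then obtain w where w: "w \<in> B" "h w = i" "int (card w) = j" by blast
    \<comment> \<open>This lets the row be written as a truncated difference of natural
      numbers.\<close>
    then have "i \<le> card w" using le by blast
    then have "j = int i + int (card w - i)" "card w = i + (card w - i)" using w by auto
    then show "\<exists>r. j = int i + int r \<and> (\<exists>w\<in>B. h w = i \<and> card w = i + r)" using w by blast
  qed auto
  finally show "graded_betti I i j \<noteq> 0 \<longleftrightarrow> (\<exists>r. j = int i + int r \<and> betti_position 0 0 i r)"
    unfolding pos .
  have "resolution_degrees I i \<noteq> [] \<longleftrightarrow> i \<in> h ` B" unfolding I by (rule graded_betti_frame(2)[OF F])
  also have "\<dots> \<longleftrightarrow> (\<exists>r. \<exists>w\<in>B. h w = i \<and> card w = i + r)"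
    using le le_Suc_ex by (fastforce simp: image_iff)
  finally show "resolution_degrees I i \<noteq> [] \<longleftrightarrow> (\<exists>r. betti_position 0 0 i r)" unfolding pos .
qed

theorem theorem4p3:
  fixes I :: "(H0_vertex, 'k::field) mpoly set" and p :: nat
  assumes "I = edge_ideal H0"
    and "p = proj_dim I"
  shows "graded_betti I p (int p + 4) = 0
       \<and> \<not> (\<exists>!ij. extremal_betti I (fst ij) (snd ij))"
proof -
  note betti = edge_ideal_H0_betti[OF assms(1)]
  note bounds = betti_position_bounds[of 0 0]
  have "p = 23" unfolding assms(2) proj_dim_def betti(2)
  proof (rule Max_eqI)
    show "finite {i. \<exists>r. betti_position 0 0 i r}"
      by (rule finite_subset[of _ "{..23}"]) (use bounds in auto)
    show "i \<le> 23" if "i \<in> {i. \<exists>r. betti_position 0 0 i r}" for i using that bounds by auto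
    show "23 \<in> {i. \<exists>r. betti_position 0 0 i r}" using betti_position_23_3 by auto
  qed
  have "graded_betti I p (int p + 4) = 0"
  proof (rule ccontr)
    assume "graded_betti I p (int p + 4) \<noteq> 0"
    then obtain r where "int r = 4" "betti_position 0 0 p r" unfolding betti(1) by auto
    then show False using bounds[of p r] \<open>p = 23\<close> by simp
  qed
  moreover have "extremal_betti I 23 26"
    unfolding extremal_betti_def
  proof (intro conjI allI impI)
    show "graded_betti I 23 26 \<noteq> 0" unfolding betti(1) using betti_position_23_3 by (intro exI[of _ 3]) simp
    fix k l assume k: "23 \<le> k \<and> 26 - int 23 \<le> l - int k \<and> (k, l) \<noteq> (23, 26)"
    show "graded_betti I k l = 0"
    proof (rule ccontr)
      assume "graded_betti I k l \<noteq> 0"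
      then obtain r where "l = int k + int r" "betti_position 0 0 k r" unfolding betti(1) by auto
      then show False using bounds[of k r] k by auto
    qed
  qed
  \<comment> \<open>Extremality compares rows: internal degree 25 in column 21 is row 4, while the
    nonzero entry at column 23 and degree 26 is only in row 3 and does not interfere.\<close>
  moreover have "extremal_betti I 21 25"
    unfolding extremal_betti_def
  proof (intro conjI allI impI)
    show "graded_betti I 21 25 \<noteq> 0" unfolding betti(1) using betti_position_21_4 by (intro exI[of _ 4]) simp
    fix k l assume k: "21 \<le> k \<and> 25 - int 21 \<le> l - int k \<and> (k, l) \<noteq> (21, 25)"
    show "graded_betti I k l = 0"
    proof (rule ccontr)
      assume "graded_betti I k l \<noteq> 0"
      then obtain r where "l = int k + int r" "betti_position 0 0 k r" unfolding betti(1) by auto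
      then show False using bounds[of k r] k by auto
    qed
  qed
  moreover have "(23 :: nat, 26 :: int) \<noteq> (21, 25)" by simp
  ultimately show ?thesis by (metis fst_conv snd_conv)
qed

end
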